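(* Suppose $U$ is a unitary operator on a composite Hilbert space $\mathcal{H}$ of dimension $d$. Then the following five statements are equivalent: (1) $\mu(U)=d$; (2) $\mathrm{Prod}(U)$ is a connected spanning set; (3) $\mathrm{Prod}(U)$ contains a connected basis as a subset; (4) $U$ admits an entanglement-free minimal identification set (EFMIS); (5) $U$ can be verified by an entanglement-free protocol.
   Context: A verification protocol for a unitary $U$ on $\mathcal{H}$ consists of a set of input test states (pure product states), each chosen with positive probability, together with a verification protocol for each corresponding output state $U|\psi_j\rangle$ based on nonadaptive local projective measurements, with verification operator $\Omega_j$; $U$ is verified reliably if only the unitary channel of $U$ passes every test with certainty. The protocol is ordinary if every $\Omega_j$ has positive spectral gap (one minus its second largest eigenvalue). One experimental setting means the preparation of a pure product input state together with one nonadaptive local projective measurement on the output state. $\mu(U)$ denotes the minimum number of experimental settings required to verify $U$ by ordinary protocols. $\mathrm{Prod}$ is the set of pure product states and $\mathrm{Prod}(U)=\{|\psi\rangle\in\mathrm{Prod} : U|\psi\rangle\in\mathrm{Prod}\}$. The transition graph of a set of pure states has the states as vertices, two vertices adjacent iff the states are non-orthogonal; the set is connected if its transition graph is connected. A connected spanning set is a connected set spanning $\mathcal{H}$; a connected basis is a connected set that is a basis of $\mathcal{H}$. An identification set (IS) is a set $\{|\psi_j\rangle\}$ of pure states such that any quantum channel $\Lambda$ with $\Lambda(|\psi_j\rangle\langle\psi_j|)=U|\psi_j\rangle\langle\psi_j|U^\dagger$ for all $j$ must equal the unitary channel of $U$; a minimal identification set (MIS) is an IS no proper subset of which is an IS (equivalently,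 a connected basis). An EFMIS for $U$ is an MIS contained in $\mathrm{Prod}(U)$. A verification protocol is entanglement free if all input test states and the corresponding output states are product states and all measurements are local projective measurements. *)

theory Defs
  imports "Jordan_Normal_Form.Jordan_Normal_Form" "Jordan_Normal_Form.VS_Connect" "HOL-Library.Extended_Nat"
begin

(* Finite-dimensional composite Hilbert space H = C^{d_1} (x) ... (x) C^{d_n},
   modelled as complex column vectors of dimension d = d_1 * ... * d_n
   (Jordan_Normal_Form vectors/matrices); tensor products = Kronecker products. *)

definition composite :: "nat list \<Rightarrow> bool" where
  "composite dims \<longleftrightarrow> length dims \<ge> 2 \<and> (\<forall>m\<in>set dims. m \<ge> 2)"

definition hdim :: "nat list \<Rightarrow> nat" where
  "hdim dims = prod_list dims"

definition braket :: "complex vec \<Rightarrow> complex vec \<Rightarrow> complex" where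
  "braket u v = conjugate u \<bullet> v"

definition dag :: "complex mat \<Rightarrow> complex mat" where
  "dag A = mat (dim_col A) (dim_row A) (\<lambda>(i,j). cnj (A $$ (j,i)))"

definition ket_bra :: "complex vec \<Rightarrow> complex vec \<Rightarrow> complex mat" where
  "ket_bra u v = mat (dim_vec u) (dim_vec v) (\<lambda>(i,j). u $ i * cnj (v $ j))"

definition mtrace :: "complex mat \<Rightarrow> complex" where
  "mtrace A = (\<Sum>i<dim_row A. A $$ (i,i))"

definition msum :: "nat \<Rightarrow> complex mat list \<Rightarrow> complex mat" where
  "msum d Ms = foldr (+) Ms (0\<^sub>m d d)"

definition kron_vec :: "complex vec \<Rightarrow> complex vec \<Rightarrow> complex vec" where
  "kron_vec a b = vec (dim_vec a * dim_vec b)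
     (\<lambda>k. a $ (k div dim_vec b) * b $ (k mod dim_vec b))"

definition kron_mat :: "complex mat \<Rightarrow> complex mat \<Rightarrow> complex mat" where
  "kron_mat A B = mat (dim_row A * dim_row B) (dim_col A * dim_col B)
     (\<lambda>(i,j). A $$ (i div dim_row B, j div dim_col B) * B $$ (i mod dim_row B, j mod dim_col B))"

fun kron_vec_list :: "complex vec list \<Rightarrow> complex vec" where
  "kron_vec_list [] = vec 1 (\<lambda>_. 1)"
| "kron_vec_list (v # vs) = kron_vec v (kron_vec_list vs)"

fun kron_mat_list :: "complex mat list \<Rightarrow> complex mat" where
  "kron_mat_list [] = 1\<^sub>m 1"
| "kron_mat_list (A # As) = kron_mat A (kron_mat_list As)"

(* pure states = unit vectors *)
definition is_state :: "nat \<Rightarrow> complex vec \<Rightarrow> bool" where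
  "is_state d v \<longleftrightarrow> v \<in> carrier_vec d \<and> braket v v = 1"

definition unitary_op :: "nat \<Rightarrow> complex mat \<Rightarrow> bool" where
  "unitary_op d U \<longleftrightarrow> U \<in> carrier_mat d d \<and> dag U * U = 1\<^sub>m d \<and> U * dag U = 1\<^sub>m d"

(* Prod: the pure product states *)
definition Prod :: "nat list \<Rightarrow> complex vec set" where
  "Prod dims = {kron_vec_list vs | vs. length vs = length dims \<and>
                  (\<forall>i<length dims. is_state (dims ! i) (vs ! i))}"

definition ProdU :: "nat list \<Rightarrow> complex mat \<Rightarrow> complex vec set" where
  "ProdU dims U = {\<psi> \<in> Prod dims. U *\<^sub>v \<psi> \<in> Prod dims}"

(* transition graph: vertices S, edges between non-orthogonal states *)
definition transition_edges :: "complex vec set \<Rightarrow> (complex vec \<times> complex vec) set" where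
  "transition_edges S = {(a,b). a \<in> S \<and> b \<in> S \<and> braket a b \<noteq> 0}"

definition connected_set :: "complex vec set \<Rightarrow> bool" where
  "connected_set S \<longleftrightarrow> (\<forall>x\<in>S. \<forall>y\<in>S. (x,y) \<in> (transition_edges S)\<^sup>*)"

definition spans :: "nat \<Rightarrow> complex vec set \<Rightarrow> bool" where
  "spans d S \<longleftrightarrow> S \<subseteq> carrier_vec d \<and>
     module.span class_ring (module_vec TYPE(complex) d) S = carrier_vec d"

definition is_basis :: "nat \<Rightarrow> complex vec set \<Rightarrow> bool" where
  "is_basis d S \<longleftrightarrow> vectorspace.basis class_ring (module_vec TYPE(complex) d) S"

definition connected_spanning_set :: "nat \<Rightarrow> complex vec set \<Rightarrow> bool" where
  "connected_spanning_set d S \<longleftrightarrow> (\<forall>v\<in>S. is_state d v) \<and> connected_set S \<and> spans d S"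

definition connected_basis :: "nat \<Rightarrow> complex vec set \<Rightarrow> bool" where
  "connected_basis d S \<longleftrightarrow> (\<forall>v\<in>S. is_state d v) \<and> connected_set S \<and> is_basis d S"

(* quantum channels on H, in Kraus form *)
definition is_channel :: "nat \<Rightarrow> complex mat list \<Rightarrow> bool" where
  "is_channel d Ks \<longleftrightarrow> (\<forall>K\<in>set Ks. K \<in> carrier_mat d d) \<and>
     msum d (map (\<lambda>K. dag K * K) Ks) = 1\<^sub>m d"

definition apply_channel :: "nat \<Rightarrow> complex mat list \<Rightarrow> complex mat \<Rightarrow> complex mat" where
  "apply_channel d Ks \<rho> = msum d (map (\<lambda>K. K * \<rho> * dag K) Ks)"

(* the channel equals the unitary channel of U *)
definition is_unitary_channel_of :: "nat \<Rightarrow> complex mat \<Rightarrow> complex mat list \<Rightarrow> bool" where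
  "is_unitary_channel_of d U Ks \<longleftrightarrow>
     (\<forall>\<rho>\<in>carrier_mat d d. apply_channel d Ks \<rho> = U * \<rho> * dag U)"

(* identification sets *)
definition is_IS :: "nat list \<Rightarrow> complex mat \<Rightarrow> complex vec set \<Rightarrow> bool" where
  "is_IS dims U S \<longleftrightarrow> (\<forall>v\<in>S. is_state (hdim dims) v) \<and>
     (\<forall>Ks. is_channel (hdim dims) Ks \<longrightarrow>
        (\<forall>\<psi>\<in>S. apply_channel (hdim dims) Ks (ket_bra \<psi> \<psi>) = ket_bra (U *\<^sub>v \<psi>) (U *\<^sub>v \<psi>)) \<longrightarrow>
        is_unitary_channel_of (hdim dims) U Ks)"

definition is_MIS :: "nat list \<Rightarrow> complex mat \<Rightarrow> complex vec set \<Rightarrow> bool" where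
  "is_MIS dims U S \<longleftrightarrow> is_IS dims U S \<and> (\<forall>T. T \<subset> S \<longrightarrow> \<not> is_IS dims U T)"

definition has_EFMIS :: "nat list \<Rightarrow> complex mat \<Rightarrow> bool" where
  "has_EFMIS dims U \<longleftrightarrow> (\<exists>S. is_MIS dims U S \<and> S \<subseteq> ProdU dims U)"

(* nonadaptive local projective measurements *)
definition projective_measurement :: "nat \<Rightarrow> complex mat list \<Rightarrow> bool" where
  "projective_measurement m Ps \<longleftrightarrow>
     (\<forall>P\<in>set Ps. P \<in> carrier_mat m m \<and> P * P = P \<and> dag P = P) \<and> msum m Ps = 1\<^sub>m m"

(* a local measurement: one projective measurement per party *)
definition local_measurement :: "nat list \<Rightarrow> complex mat list list \<Rightarrow> bool" where
  "local_measurement dims Ms \<longleftrightarrow> length Ms = length dims \<and>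
     (\<forall>i<length dims. projective_measurement (dims ! i) (Ms ! i))"

definition outcome :: "complex mat list list \<Rightarrow> nat list \<Rightarrow> bool" where
  "outcome Ms as \<longleftrightarrow> length as = length Ms \<and> (\<forall>i<length Ms. as ! i < length (Ms ! i))"

definition outcome_proj :: "complex mat list list \<Rightarrow> nat list \<Rightarrow> complex mat" where
  "outcome_proj Ms as = kron_mat_list (map (\<lambda>i. Ms ! i ! (as ! i)) [0..<length Ms])"

(* a test: a local projective measurement together with the (distinct) accepted outcomes *)
type_synonym test = "complex mat list list \<times> nat list list"

definition valid_test :: "nat list \<Rightarrow> test \<Rightarrow> bool" where
  "valid_test dims t \<longleftrightarrow> local_measurement dims (fst t) \<and> distinct (snd t) \<and>
     (\<forall>as\<in>set (snd t). outcome (fst t) as)"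

definition test_proj :: "nat list \<Rightarrow> test \<Rightarrow> complex mat" where
  "test_proj dims t = msum (hdim dims) (map (outcome_proj (fst t)) (snd t))"

(* verification protocol for a pure state: tests chosen with positive probabilities,
   each passed by the target state with certainty *)
definition state_protocol :: "nat list \<Rightarrow> complex vec \<Rightarrow> (test \<times> real) list \<Rightarrow> bool" where
  "state_protocol dims \<psi> ts \<longleftrightarrow> ts \<noteq> [] \<and>
     (\<forall>(t,p)\<in>set ts. valid_test dims t \<and> p > 0 \<and> test_proj dims t *\<^sub>v \<psi> = \<psi>) \<and>
     sum_list (map snd ts) = 1"

definition verification_operator :: "nat list \<Rightarrow> (test \<times> real) list \<Rightarrow> complex mat" where
  "verification_operator dims ts =
     msum (hdim dims) (map (\<lambda>(t,p). complex_of_real p \<cdot>\<^sub>m test_proj dims t) ts)"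

(* eigenvalues counted with multiplicity (roots of the characteristic polynomial);
   the verification operator is Hermitian, so they are real *)
definition eig_mset :: "complex mat \<Rightarrow> complex multiset" where
  "eig_mset A = (\<Sum>a\<in>{a. poly (char_poly A) a = 0}. replicate_mset (Polynomial.order a (char_poly A)) a)"

definition second_largest_eigenvalue :: "complex mat \<Rightarrow> real" where
  "second_largest_eigenvalue A = rev (sorted_list_of_multiset (image_mset Re (eig_mset A))) ! 1"

definition spectral_gap :: "complex mat \<Rightarrow> real" where
  "spectral_gap A = 1 - second_largest_eigenvalue A"

(* verification protocol for a gate U: input product states with positive probabilities,
   each with a verification protocol for the output state U psi *)
type_synonym gate_protocol = "(complex vec \<times> real \<times> (test \<times> real) list) list"

definition gate_protocol :: "nat list \<Rightarrow> complex mat \<Rightarrow> gate_protocol \<Rightarrow> bool" where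
  "gate_protocol dims U pr \<longleftrightarrow> pr \<noteq> [] \<and>
     (\<forall>(\<psi>,q,ts)\<in>set pr. \<psi> \<in> Prod dims \<and> q > 0 \<and> state_protocol dims (U *\<^sub>v \<psi>) ts) \<and>
     sum_list (map (fst \<circ> snd) pr) = 1"

definition passes_all_tests :: "nat list \<Rightarrow> gate_protocol \<Rightarrow> complex mat list \<Rightarrow> bool" where
  "passes_all_tests dims pr Ks \<longleftrightarrow>
     (\<forall>(\<psi>,q,ts)\<in>set pr. \<forall>(t,p)\<in>set ts.
        mtrace (test_proj dims t * apply_channel (hdim dims) Ks (ket_bra \<psi> \<psi>)) = 1)"

definition reliable :: "nat list \<Rightarrow> complex mat \<Rightarrow> gate_protocol \<Rightarrow> bool" where
  "reliable dims U pr \<longleftrightarrow> (\<forall>Ks. is_channel (hdim dims) Ks \<longrightarrow>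
     passes_all_tests dims pr Ks \<longrightarrow> is_unitary_channel_of (hdim dims) U Ks)"

definition ordinary :: "nat list \<Rightarrow> gate_protocol \<Rightarrow> bool" where
  "ordinary dims pr \<longleftrightarrow> (\<forall>(\<psi>,q,ts)\<in>set pr. spectral_gap (verification_operator dims ts) > 0)"

(* one setting = one input state together with one local measurement *)
definition num_settings :: "gate_protocol \<Rightarrow> nat" where
  "num_settings pr = sum_list (map (\<lambda>(\<psi>,q,ts). length ts) pr)"

definition mu :: "nat list \<Rightarrow> complex mat \<Rightarrow> enat" where
  "mu dims U = (INF pr \<in> {pr. gate_protocol dims U pr \<and> ordinary dims pr \<and> reliable dims U pr}.
                  enat (num_settings pr))"

definition entanglement_free :: "nat list \<Rightarrow> complex mat \<Rightarrow> gate_protocol \<Rightarrow> bool" where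
  "entanglement_free dims U pr \<longleftrightarrow> (\<forall>(\<psi>,q,ts)\<in>set pr. \<psi> \<in> Prod dims \<and> U *\<^sub>v \<psi> \<in> Prod dims)"

definition EF_verifiable :: "nat list \<Rightarrow> complex mat \<Rightarrow> bool" where
  "EF_verifiable dims U \<longleftrightarrow>
     (\<exists>pr. gate_protocol dims U pr \<and> reliable dims U pr \<and> entanglement_free dims U pr)"

end

theory Submission
  imports Defs "Jordan_Normal_Form.Schur_Decomposition"
begin

text \<open>If a channel with Kraus operators \<open>K\<close> sends a state \<open>v\<close> to \<open>U v\<close> with certainty, then
  \<open>K v = c\<^sub>K(v) U v\<close>. Since the Kraus operators together preserve inner products, the vectors
  \<open>(c\<^sub>K(v))\<^sub>K\<close> have norm one and coincide for non-orthogonal states, so on a connected spanning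
  set they are constant and every \<open>K\<close> is a multiple of \<open>U\<close>. Conversely, if a set is not connected and
  spanning, then the reflection at the span of one of its components fixes all of its density
  matrices without being a scalar. Hence identification sets are exactly the connected spanning sets,
  and the input states of any reliable protocol form one; in particular at least \<open>d\<close> settings are
  needed. Equality forces one test per input, and a test with positive spectral gap has only
  one fixed state, which must be a product state. A connected spanning set contains a connected
  basis, because a maximal connected independent subset already spans.\<close>

subsection \<open>Inner products, matrices and traces\<close>

text \<open>Statement (2) speaks of all of \<open>ProdU\<close>, while protocols and identification
  sets only provide subsets of it. Connectedness is not monotone in general, but no state is
  orthogonal to a whole spanning set, so a connected spanning set stays connected when states are
  added. Hence (1), (4) and (5) each only have to yield some identification set inside
  \<open>ProdU\<close>, and conversely each is built from a connected basis.

  The obstacle is the spectral gap. It is read off the sorted roots of the characteristic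
  polynomial, so it sees algebraic multiplicity, whereas the argument produces fixed vectors. The
  two are compared without diagonalizing Hermitian matrices: two independent fixed vectors make the
  characteristic polynomial and its derivative vanish at 1, and for a rank-one projector the
  nonnegative eigenvalues add up to the trace 1, which keeps the second one below 1.\<close>

lemma braket_eq_sum:
  assumes "u \<in> carrier_vec n" "v \<in> carrier_vec n"
  shows "braket u v = (\<Sum>i<n. cnj (u $ i) * v $ i)"
  using assms by (auto simp: braket_def scalar_prod_def lessThan_atLeast0 conjugate_complex_def intro!: sum.cong)

lemma braket_add_right:
  assumes "u \<in> carrier_vec n" "v \<in> carrier_vec n" "w \<in> carrier_vec n"
  shows "braket u (v + w) = braket u v + braket u w"
  using assms by (simp add: braket_eq_sum[of _ n] sum.distrib distrib_left)

lemma braket_diff_right: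
  assumes "u \<in> carrier_vec n" "v \<in> carrier_vec n" "w \<in> carrier_vec n"
  shows "braket u (v - w) = braket u v - braket u w"
  using assms by (simp add: braket_eq_sum[of _ n] sum_subtractf right_diff_distrib)

lemma braket_diff_left:
  assumes "u \<in> carrier_vec n" "v \<in> carrier_vec n" "w \<in> carrier_vec n"
  shows "braket (v - w) u = braket v u - braket w u"
  using assms by (simp add: braket_eq_sum[of _ n] sum_subtractf left_diff_distrib)

lemma braket_smult_right:
  assumes "u \<in> carrier_vec n" "v \<in> carrier_vec n"
  shows "braket u (c \<cdot>\<^sub>v v) = c * braket u v"
  using assms by (simp add: braket_eq_sum[of _ n] sum_distrib_left algebra_simps)

lemma braket_smult_left:
  assumes "u \<in> carrier_vec n" "v \<in> carrier_vec n"
  shows "braket (c \<cdot>\<^sub>v u) v = cnj c * braket u v"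
  using assms by (simp add: braket_eq_sum[of _ n] sum_distrib_left algebra_simps)

lemma braket_zero_right [simp]:
  assumes "u \<in> carrier_vec n"
  shows "braket u (0\<^sub>v n) = 0"
  using assms by (simp add: braket_eq_sum[of _ n])

lemma braket_zero_left [simp]:
  assumes "u \<in> carrier_vec n"
  shows "braket (0\<^sub>v n) u = 0"
  using assms by (simp add: braket_eq_sum[of _ n])

lemma cnj_braket:
  assumes "u \<in> carrier_vec n" "v \<in> carrier_vec n"
  shows "cnj (braket u v) = braket v u"
  using assms by (simp add: braket_eq_sum[of _ n] cnj_sum mult.commute)

lemma braket_eq_0_commute:
  assumes "u \<in> carrier_vec n" "v \<in> carrier_vec n"
  shows "braket u v = 0 \<longleftrightarrow> braket v u = 0"
  using cnj_braket[OF assms] by (metis complex_cnj_zero_iff)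

lemma braket_self:
  assumes "v \<in> carrier_vec n"
  shows "braket v v = complex_of_real (\<Sum>i<n. (cmod (v $ i))\<^sup>2)"
proof -
  have *: "cnj z * z = complex_of_real ((cmod z)\<^sup>2)" for z
    by (metis complex_norm_square mult.commute)
  then show ?thesis
    using assms by (simp only: braket_eq_sum[of _ n] of_real_sum)
qed

lemma braket_self_real:
  assumes "v \<in> carrier_vec n"
  shows "Im (braket v v) = 0" "Re (braket v v) \<ge> 0"
  using braket_self[OF assms] by (auto intro: sum_nonneg)

lemma braket_self_eq_0:
  assumes "v \<in> carrier_vec n" "braket v v = 0"
  shows "v = 0\<^sub>v n"
proof -
  have "(\<Sum>i<n. (cmod (v $ i))\<^sup>2) = 0"
    using assms by (metis braket_self of_real_eq_0_iff)
  then have "\<forall>i<n. v $ i = 0"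
    by (subst (asm) sum_nonneg_eq_0_iff) auto
  then show ?thesis
    using assms by (intro eq_vecI) auto
qed

lemma is_state_carrier: "is_state d v \<Longrightarrow> v \<in> carrier_vec d"
  by (simp add: is_state_def)

lemma is_state_braket: "is_state d v \<Longrightarrow> braket v v = 1"
  by (simp add: is_state_def)

lemma is_state_nonzero:
  assumes "is_state d v"
  shows "v \<noteq> 0\<^sub>v d"
  using assms unfolding is_state_def by auto

lemma normalize_to_state:
  assumes "v \<in> carrier_vec d" "v \<noteq> 0\<^sub>v d"
  obtains c where "is_state d (c \<cdot>\<^sub>v v)" "c \<noteq> 0"
proof -
  define r where "r = Re (braket v v)"
  have r: "braket v v = complex_of_real r" "r \<ge> 0" "r \<noteq> 0"
    using braket_self_real[OF assms(1)] braket_self_eq_0[OF assms(1)] assms(2)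
    by (auto simp: r_def complex_eq_iff)
  define c where "c = complex_of_real (1 / sqrt r)"
  have "braket (c \<cdot>\<^sub>v v) (c \<cdot>\<^sub>v v) = cnj c * (c * complex_of_real r)"
    using assms(1) by (simp add: braket_smult_left[of _ d] braket_smult_right[of _ d] r(1) mult.left_commute)
  also have "\<dots> = complex_of_real (1 / sqrt r * (1 / sqrt r * r))"
    unfolding c_def by (simp only: complex_cnj_complex_of_real of_real_mult)
  also have "1 / sqrt r * (1 / sqrt r * r) = 1"
    using r by (simp add: field_simps)
  finally have "braket (c \<cdot>\<^sub>v v) (c \<cdot>\<^sub>v v) = 1"
    by simp
  then have "is_state d (c \<cdot>\<^sub>v v)"
    unfolding is_state_def using assms(1) by auto
  moreover have "c \<noteq> 0"
    using r by (simp add: c_def)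
  ultimately show thesis
    using that by blast
qed

section \<open>Adjoints, rank-one operators and traces\<close>

lemma dag_carrier [simp]: "A \<in> carrier_mat n m \<Longrightarrow> dag A \<in> carrier_mat m n"
  by (auto simp: dag_def)

lemma index_dag [simp]: "i < dim_col A \<Longrightarrow> j < dim_row A \<Longrightarrow> dag A $$ (i, j) = cnj (A $$ (j, i))"
  by (simp add: dag_def)

lemma dim_dag [simp]: "dim_row (dag A) = dim_col A" "dim_col (dag A) = dim_row A"
  by (simp_all add: dag_def)

lemma dag_dag [simp]: "dag (dag A) = A"
  by (intro eq_matI) auto

lemma mult_mat_index_sum:
  assumes "A \<in> carrier_mat n m" "B \<in> carrier_mat m k" "i < n" "j < k"
  shows "(A * B) $$ (i, j) = (\<Sum>l<m. A $$ (i, l) * B $$ (l, j))"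
  using assms by (auto simp: scalar_prod_def lessThan_atLeast0 intro!: sum.cong)

lemma mult_mat_vec_index_sum:
  assumes "A \<in> carrier_mat n m" "v \<in> carrier_vec m" "i < n"
  shows "(A *\<^sub>v v) $ i = (\<Sum>l<m. A $$ (i, l) * v $ l)"
  using assms by (auto simp: scalar_prod_def lessThan_atLeast0 intro!: sum.cong)

lemma dag_mult:
  assumes "A \<in> carrier_mat n m" "B \<in> carrier_mat m k"
  shows "dag (A * B) = dag B * dag A"
proof (rule eq_matI)
  fix i j
  assume "i < dim_row (dag B * dag A)" "j < dim_col (dag B * dag A)"
  then have ij: "i < k" "j < n"
    using assms by auto
  then have "dag (A * B) $$ (i, j) = cnj (\<Sum>l<m. A $$ (j, l) * B $$ (l, i))"
    using assms by (subst index_dag) (auto simp: mult_mat_index_sum[of _ n m _ k] simp del: index_mult_mat(1))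
  also have "\<dots> = (\<Sum>l<m. dag B $$ (i, l) * dag A $$ (l, j))"
    using assms ij by (auto simp: cnj_sum mult.commute intro!: sum.cong)
  also have "\<dots> = (dag B * dag A) $$ (i, j)"
    using assms ij by (subst mult_mat_index_sum[of _ k m _ n]) auto
  finally show "dag (A * B) $$ (i, j) = (dag B * dag A) $$ (i, j)" .
qed (use assms in auto)

lemma dag_add:
  assumes "A \<in> carrier_mat n m" "B \<in> carrier_mat n m"
  shows "dag (A + B) = dag A + dag B"
  using assms by (intro eq_matI) auto

lemma dag_diff:
  assumes "A \<in> carrier_mat n m" "B \<in> carrier_mat n m"
  shows "dag (A - B) = dag A - dag B"
  using assms by (intro eq_matI) auto

lemma dag_one [simp]: "dag (1\<^sub>m n) = 1\<^sub>m n"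
  by (intro eq_matI) auto

lemma braket_mult_mat_vec:
  assumes "A \<in> carrier_mat n m" "u \<in> carrier_vec n" "v \<in> carrier_vec m"
  shows "braket u (A *\<^sub>v v) = braket (dag A *\<^sub>v u) v"
proof -
  have "braket u (A *\<^sub>v v) = (\<Sum>i<n. \<Sum>l<m. cnj (u $ i) * A $$ (i, l) * v $ l)"
    using assms by (simp add: braket_eq_sum[of _ n] mult_mat_vec_index_sum[of _ n m] sum_distrib_left
        mult.assoc del: index_mult_mat_vec)
  also have "\<dots> = (\<Sum>l<m. \<Sum>i<n. cnj (u $ i) * A $$ (i, l) * v $ l)"
    by (rule sum.swap)
  also have "\<dots> = (\<Sum>l<m. cnj (\<Sum>i<n. dag A $$ (l, i) * u $ i) * v $ l)"
    using assms by (intro sum.cong refl) (auto simp: cnj_sum sum_distrib_left sum_distrib_right mult_ac intro!: sum.cong)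
  also have "\<dots> = braket (dag A *\<^sub>v u) v"
    using assms mult_mat_vec_carrier[OF dag_carrier[OF assms(1)] assms(2)]
    by (simp add: braket_eq_sum[of _ m] mult_mat_vec_index_sum[of _ m n] del: index_mult_mat_vec index_dag)
  finally show ?thesis .
qed

lemma dim_ket_bra [simp]: "dim_row (ket_bra u v) = dim_vec u" "dim_col (ket_bra u v) = dim_vec v"
  by (simp_all add: ket_bra_def)

lemma index_ket_bra [simp]: "i < dim_vec u \<Longrightarrow> j < dim_vec v \<Longrightarrow> ket_bra u v $$ (i, j) = u $ i * cnj (v $ j)"
  by (simp add: ket_bra_def)

lemma ket_bra_carrier [simp]: "u \<in> carrier_vec n \<Longrightarrow> v \<in> carrier_vec m \<Longrightarrow> ket_bra u v \<in> carrier_mat n m"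
  by (auto simp: ket_bra_def)

lemma dag_ket_bra [simp]: "dag (ket_bra u v) = ket_bra v u"
  by (intro eq_matI) auto

lemma ket_bra_mult_vec:
  assumes "u \<in> carrier_vec n" "v \<in> carrier_vec m" "w \<in> carrier_vec m"
  shows "ket_bra u v *\<^sub>v w = braket v w \<cdot>\<^sub>v u"
proof (rule eq_vecI)
  fix i
  assume "i < dim_vec (braket v w \<cdot>\<^sub>v u)"
  then have "i < n"
    using assms by simp
  then show "(ket_bra u v *\<^sub>v w) $ i = (braket v w \<cdot>\<^sub>v u) $ i"
    using assms by (auto simp: mult_mat_vec_index_sum[of _ n m] braket_eq_sum[of _ m] sum_distrib_left
        mult_ac simp del: index_mult_mat_vec intro!: sum.cong)
qed (use assms in auto)

lemma mult_ket_bra: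
  assumes "A \<in> carrier_mat k n" "u \<in> carrier_vec n" "v \<in> carrier_vec m"
  shows "A * ket_bra u v = ket_bra (A *\<^sub>v u) v"
proof (rule eq_matI)
  fix i j
  assume "i < dim_row (ket_bra (A *\<^sub>v u) v)" "j < dim_col (ket_bra (A *\<^sub>v u) v)"
  then have "i < k" "j < m"
    using assms by auto
  then show "(A * ket_bra u v) $$ (i, j) = ket_bra (A *\<^sub>v u) v $$ (i, j)"
    using assms by (auto simp: mult_mat_vec_index_sum[of _ k n] mult_mat_index_sum[of _ k n _ m] sum_distrib_left
        sum_distrib_right mult_ac simp del: index_mult_mat_vec index_mult_mat(1) intro!: sum.cong)
qed (use assms in auto)

lemma ket_bra_mult_dag:
  assumes "A \<in> carrier_mat k m" "u \<in> carrier_vec n" "v \<in> carrier_vec m"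
  shows "ket_bra u v * dag A = ket_bra u (A *\<^sub>v v)"
proof -
  have "dag (ket_bra u v * dag A) = A * ket_bra v u"
    using assms by (subst dag_mult[of _ n m _ k]) auto
  also have "\<dots> = ket_bra (A *\<^sub>v v) u"
    using assms by (intro mult_ket_bra)
  finally have "dag (dag (ket_bra u v * dag A)) = dag (ket_bra (A *\<^sub>v v) u)"
    by simp
  then show ?thesis
    by simp
qed

lemma eq_mat_on_vecs:
  fixes A B :: "complex mat"
  assumes "A \<in> carrier_mat n m" "B \<in> carrier_mat n m"
    and "\<And>v. v \<in> carrier_vec m \<Longrightarrow> A *\<^sub>v v = B *\<^sub>v v"
  shows "A = B"
proof (rule eq_matI)
  fix i j
  assume "i < dim_row B" "j < dim_col B"
  then have ij: "i < n" "j < m"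
    using assms by auto
  then have "(A *\<^sub>v unit_vec m j) $ i = (B *\<^sub>v unit_vec m j) $ i"
    using assms by simp
  then show "A $$ (i, j) = B $$ (i, j)"
    using assms(1,2) ij by auto
qed (use assms in auto)

lemma mtrace_eq_sum: "A \<in> carrier_mat n m \<Longrightarrow> mtrace A = (\<Sum>i<n. A $$ (i, i))"
  by (auto simp: mtrace_def)

lemma mtrace_mult_commute:
  assumes "A \<in> carrier_mat n m" "B \<in> carrier_mat m n"
  shows "mtrace (A * B) = mtrace (B * A)"
proof -
  have "mtrace (A * B) = (\<Sum>i<n. \<Sum>l<m. A $$ (i, l) * B $$ (l, i))"
    using assms by (simp add: mtrace_eq_sum[of _ n n] mult_mat_index_sum[of _ n m _ n] del: index_mult_mat(1))
  also have "\<dots> = (\<Sum>l<m. \<Sum>i<n. B $$ (l, i) * A $$ (i, l))"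
    by (subst sum.swap) (simp add: mult.commute)
  also have "\<dots> = mtrace (B * A)"
    using assms by (simp add: mtrace_eq_sum[of _ m m] mult_mat_index_sum[of _ m n _ m] del: index_mult_mat(1))
  finally show ?thesis .
qed

lemma mtrace_ket_bra:
  assumes "u \<in> carrier_vec n" "v \<in> carrier_vec n"
  shows "mtrace (ket_bra u v) = braket v u"
  using assms by (simp add: mtrace_eq_sum[of _ n n] braket_eq_sum[of _ n] mult.commute)

section \<open>Finite sums of square matrices\<close>

lemma msum_Nil [simp]: "msum d [] = 0\<^sub>m d d"
  by (simp add: msum_def)

lemma msum_Cons [simp]: "msum d (A # As) = A + msum d As"
  by (simp add: msum_def)

lemma msum_carrier [simp]: "(\<And>A. A \<in> set As \<Longrightarrow> A \<in> carrier_mat d d) \<Longrightarrow> msum d As \<in> carrier_mat d d"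
  by (induction As) auto

lemma index_msum:
  assumes "\<And>A. A \<in> set As \<Longrightarrow> A \<in> carrier_mat d d" "i < d" "j < d"
  shows "msum d As $$ (i, j) = (\<Sum>A\<leftarrow>As. A $$ (i, j))"
  using assms(1)
proof (induction As)
  case (Cons A As)
  have "msum d As \<in> carrier_mat d d"
    using Cons.prems by auto
  then have "(A + msum d As) $$ (i, j) = A $$ (i, j) + msum d As $$ (i, j)"
    using assms(2,3) by simp
  then show ?case
    using Cons.IH Cons.prems by simp
qed (use assms in simp)

lemma mtrace_msum:
  assumes "\<And>A. A \<in> set As \<Longrightarrow> A \<in> carrier_mat d d"
  shows "mtrace (msum d As) = (\<Sum>A\<leftarrow>As. mtrace A)"
proof -
  have "mtrace (msum d As) = (\<Sum>i<d. \<Sum>A\<leftarrow>As. A $$ (i, i))"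
    using assms by (subst mtrace_eq_sum[of _ d d]) (auto simp: index_msum)
  also have "\<dots> = (\<Sum>A\<leftarrow>As. \<Sum>i<d. A $$ (i, i))"
    by (induction As) (auto simp: sum.distrib)
  also have "map (\<lambda>A. \<Sum>i<d. A $$ (i, i)) As = map mtrace As"
    using assms by (auto simp: mtrace_eq_sum[of _ d d])
  finally show ?thesis .
qed

lemma mult_msum:
  assumes "\<And>A. A \<in> set As \<Longrightarrow> A \<in> carrier_mat d d" "B \<in> carrier_mat d d"
  shows "B * msum d As = msum d (map ((*) B) As)"
  using assms(1)
proof (induction As)
  case (Cons A As)
  have "A \<in> carrier_mat d d" "msum d As \<in> carrier_mat d d"
    using Cons.prems by auto
  then have "B * (A + msum d As) = B * A + B * msum d As"
    using assms(2) by (intro mult_add_distrib_mat)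
  then show ?case
    using Cons.IH Cons.prems by simp
qed (use assms in simp)

text \<open>Testing against \<open>u\<close> replaces a sum of vectors, whose zero depends on the
  dimension, by a sum of complex numbers. Vector identities are later recovered by showing that a
  difference is orthogonal to itself.\<close>

lemma braket_msum_mult_vec:
  assumes "\<And>A. A \<in> set As \<Longrightarrow> A \<in> carrier_mat d d" "u \<in> carrier_vec d" "v \<in> carrier_vec d"
  shows "braket u (msum d As *\<^sub>v v) = (\<Sum>A\<leftarrow>As. braket u (A *\<^sub>v v))"
  using assms(1)
proof (induction As)
  case (Cons A As)
  have *: "A \<in> carrier_mat d d" "msum d As \<in> carrier_mat d d"
    using Cons.prems by auto
  then have "(A + msum d As) *\<^sub>v v = A *\<^sub>v v + msum d As *\<^sub>v v"
    using assms(3) by (intro add_mult_distrib_mat_vec)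
  moreover have "A *\<^sub>v v \<in> carrier_vec d" "msum d As *\<^sub>v v \<in> carrier_vec d"
    using * assms(3) by (auto intro: mult_mat_vec_carrier)
  ultimately have "braket u ((A + msum d As) *\<^sub>v v) = braket u (A *\<^sub>v v) + braket u (msum d As *\<^sub>v v)"
    using assms(2) by (simp add: braket_add_right[of _ d])
  then show ?case
    using Cons.IH Cons.prems by simp
next
  case Nil
  have "0\<^sub>m d d *\<^sub>v v = 0\<^sub>v d"
    using assms(3) by (intro eq_vecI) auto
  then show ?case
    using assms(2) by simp
qed

subsection \<open>Spans and orthogonal projectors\<close>

abbreviation cspan :: "nat \<Rightarrow> complex vec set \<Rightarrow> complex vec set" where
  "cspan d \<equiv> module.span class_ring (module_vec TYPE(complex) d)"

abbreviation cindep :: "nat \<Rightarrow> complex vec set \<Rightarrow> bool" where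
  "cindep d T \<equiv> \<not> module.lin_dep class_ring (module_vec TYPE(complex) d) T"

lemma cspan_carrier:
  assumes "S \<subseteq> carrier_vec d"
  shows "cspan d S \<subseteq> carrier_vec d"
proof -
  interpret vec_space "TYPE(complex)" d .
  show ?thesis
    using span_is_subset2[of S] assms by simp
qed

lemma cspan_superset:
  assumes "S \<subseteq> carrier_vec d"
  shows "S \<subseteq> cspan d S"
proof -
  interpret vec_space "TYPE(complex)" d .
  show ?thesis
    using in_own_span[of S] assms by simp
qed

lemma cspan_mono:
  assumes "S \<subseteq> T"
  shows "cspan d S \<subseteq> cspan d T"
proof -
  interpret vec_space "TYPE(complex)" d .
  show ?thesis
    using span_is_monotone[of S T] assms by simp
qed

lemma cspan_closed:
  assumes "S \<subseteq> carrier_vec d" "u \<in> cspan d S" "v \<in> cspan d S"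
  shows "u + v \<in> cspan d S" "c \<cdot>\<^sub>v u \<in> cspan d S" "u - v \<in> cspan d S" "0\<^sub>v d \<in> cspan d S"
proof -
  interpret vec_space "TYPE(complex)" d .
  have uv: "u \<in> carrier_vec d" "v \<in> carrier_vec d"
    using cspan_carrier[OF assms(1)] assms(2,3) by auto
  have add: "u + v \<in> cspan d S" if "v \<in> cspan d S" for v
    using span_add1[of S u v] assms that by simp
  have smult: "c \<cdot>\<^sub>v u \<in> cspan d S" if "u \<in> cspan d S" for c u
    using smult_in_span[OF assms(1) that] by simp
  have "u - v = u + (- 1) \<cdot>\<^sub>v v"
    using uv by (intro eq_vecI) auto
  then show "u + v \<in> cspan d S" "c \<cdot>\<^sub>v u \<in> cspan d S" "u - v \<in> cspan d S"
    using add[OF assms(3)] smult[OF assms(2)] add[OF smult[OF assms(3)]] by simp_all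
  show "0\<^sub>v d \<in> cspan d S"
    using span_zero[of S] by simp
qed

text \<open>The closure conditions make the vectors of the carrier satisfying \<open>P\<close> a
  submodule that contains \<open>S\<close>, hence its span.\<close>

lemma cspan_induct [consumes 2, case_names base zero add smult]:
  assumes "v \<in> cspan d S" "S \<subseteq> carrier_vec d"
    and "\<And>v. v \<in> S \<Longrightarrow> P v" "P (0\<^sub>v d)"
    and "\<And>u v. \<lbrakk>u \<in> carrier_vec d; v \<in> carrier_vec d; P u; P v\<rbrakk> \<Longrightarrow> P (u + v)"
    and "\<And>c v. \<lbrakk>v \<in> carrier_vec d; P v\<rbrakk> \<Longrightarrow> P (c \<cdot>\<^sub>v v)"
  shows "P v"
proof -
  interpret vec_space "TYPE(complex)" d .
  have "submodule class_ring {v \<in> carrier_vec d. P v} V"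
    unfolding submodule_def using assms vec_module by auto
  then have "span S \<subseteq> {v \<in> carrier_vec d. P v}"
    by (intro span_is_subset) (use assms in auto)
  then show ?thesis
    using assms(1) by auto
qed

lemma eq_mat_on_spanning:
  assumes "A \<in> carrier_mat d d" "B \<in> carrier_mat d d" "spans d S"
    and "\<And>v. v \<in> S \<Longrightarrow> A *\<^sub>v v = B *\<^sub>v v"
  shows "A = B"
proof (rule eq_mat_on_vecs[OF assms(1,2)])
  fix v :: "complex vec"
  assume "v \<in> carrier_vec d"
  then have "v \<in> cspan d S" "S \<subseteq> carrier_vec d"
    using assms(3) by (auto simp: spans_def)
  then show "A *\<^sub>v v = B *\<^sub>v v"
  proof (induction v rule: cspan_induct)
    case zero
    have "A *\<^sub>v 0\<^sub>v d = 0\<^sub>v d" "B *\<^sub>v 0\<^sub>v d = 0\<^sub>v d"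
      using assms(1,2) by (auto intro!: eq_vecI)
    then show ?case
      by simp
  next
    case (add u v)
    then show ?case
      using assms(1,2) by (simp add: mult_add_distrib_mat_vec[of _ d d])
  next
    case (smult c v)
    then show ?case
      using assms(1,2) by (simp add: mult_mat_vec[of _ d d])
  qed (use assms(4) in auto)
qed

lemma braket_cspan_eq_0:
  assumes "v \<in> cspan d S" "S \<subseteq> carrier_vec d" "u \<in> carrier_vec d"
    and "\<And>s. s \<in> S \<Longrightarrow> braket u s = 0"
  shows "braket u v = 0"
  using assms(1,2)
proof (induction v rule: cspan_induct)
  case (add v w)
  then show ?case
    using assms(3) by (simp add: braket_add_right[of _ d])
next
  case (smult c v)
  then show ?case
    using assms(3) by (simp add: braket_smult_right[of _ d])
qed (use assms(3,4) in auto)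

lemma cindep_insert:
  assumes "T \<subseteq> carrier_vec d" "cindep d T" "v \<in> carrier_vec d" "v \<notin> cspan d T"
  shows "cindep d (insert v T)" "v \<notin> T"
proof -
  interpret vec_space "TYPE(complex)" d .
  show "v \<notin> T"
    using cspan_superset[OF assms(1)] assms(4) by auto
  then show "cindep d (insert v T)"
    using lin_dep_iff_in_span[of T v] assms by simp
qed

lemma cindep_empty: "cindep d {}"
proof -
  interpret vec_space "TYPE(complex)" d .
  show ?thesis
    unfolding lin_dep_def by auto
qed

lemma cindep_finite_card:
  assumes "T \<subseteq> carrier_vec d" "cindep d T"
  shows "finite T" "card T \<le> d"
proof -
  interpret vec_space "TYPE(complex)" d .
  show "finite T" "card T \<le> d"
    using li_le_dim[of T] assms fin_dim dim_is_n by auto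
qed

lemma spans_imp_card_ge:
  assumes "spans d S" "finite S"
  shows "d \<le> card S"
proof -
  interpret vec_space "TYPE(complex)" d .
  show ?thesis
    using gen_ge_dim[of S] assms dim_is_n by (auto simp: spans_def)
qed

lemma is_basis_iff: "is_basis d B \<longleftrightarrow> spans d B \<and> cindep d B"
proof -
  interpret vec_space "TYPE(complex)" d .
  show ?thesis
    unfolding is_basis_def spans_def basis_def by auto
qed

lemma is_basis_finite_card:
  assumes "is_basis d B"
  shows "finite B" "card B = d"
proof -
  have *: "spans d B" "cindep d B"
    using assms is_basis_iff by auto
  then show "finite B"
    using cindep_finite_card[of B d] by (auto simp: spans_def)
  then show "card B = d"
    using * cindep_finite_card[of B d] spans_imp_card_ge[of d B] by (auto simp: spans_def)
qed

text \<open>Independent sets have at most \<open>d\<close> elements, so a set of greatest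
  cardinality exists even when \<open>S\<close> is infinite. The side condition \<open>Q\<close>
  lets the same argument serve twice: trivial for the projector onto a span, connectedness for the
  extraction of a connected basis.\<close>

lemma maximal_cindep:
  assumes "S \<subseteq> carrier_vec d" "T0 \<subseteq> S" "cindep d T0" "Q T0"
  obtains T where "T \<subseteq> S" "cindep d T" "finite T" "Q T"
    "\<And>v. v \<in> S \<Longrightarrow> Q (insert v T) \<Longrightarrow> v \<in> cspan d T"
proof -
  let ?P = "\<lambda>T. T \<subseteq> S \<and> cindep d T \<and> Q T"
  have "\<forall>T. ?P T \<longrightarrow> card T \<le> d"
    using cindep_finite_card(2) assms(1) by blast
  then have "\<exists>T. ?P T \<and> (\<forall>T'. ?P T' \<longrightarrow> card T' \<le> card T)"
    using ex_has_greatest_nat[of ?P T0 card "Suc d"] assms by (simp add: less_Suc_eq_le)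
  then obtain T where T: "?P T" and max: "\<And>T'. ?P T' \<Longrightarrow> card T' \<le> card T"
    by blast
  have T': "T \<subseteq> carrier_vec d" "finite T"
    using T assms(1) cindep_finite_card(1) by blast+
  show thesis
  proof (rule that[of T])
    fix v
    assume v: "v \<in> S" "Q (insert v T)"
    show "v \<in> cspan d T"
    proof (rule ccontr)
      assume "v \<notin> cspan d T"
      then have "cindep d (insert v T)" "v \<notin> T"
        using cindep_insert[of T d v] T T' v assms(1) by auto
      then have "card (insert v T) \<le> card T"
        using max[of "insert v T"] T v by auto
      then show False
        using T' \<open>v \<notin> T\<close> by simp
    qed
  qed (use T T' in auto)
qed

lemma cspan_eq_carrierI:
  assumes "spans d S" "T \<subseteq> S" "S \<subseteq> cspan d T"
  shows "spans d T"
proof -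
  interpret vec_space "TYPE(complex)" d .
  have "T \<subseteq> carrier_vec d"
    using assms by (auto simp: spans_def)
  then show ?thesis
    using assms span_subsetI[of T S] cspan_carrier[of T d] by (auto simp: spans_def)
qed

lemma add_diff_cancel_vec:
  fixes u v :: "complex vec"
  assumes "u \<in> carrier_vec d" "v \<in> carrier_vec d"
  shows "u + (v - u) = v"
  using assms by (intro eq_vecI) auto

section \<open>Orthogonal projectors onto spans\<close>

definition projector :: "nat \<Rightarrow> complex mat \<Rightarrow> bool" where
  "projector d P \<longleftrightarrow> P \<in> carrier_mat d d \<and> P * P = P \<and> dag P = P"

text \<open>One Gram-Schmidt step at the level of projectors: \<open>P w = 0\<close> kills both
  cross terms of the square.\<close>

lemma projector_add_ket_bra:
  assumes P: "projector d P" and w: "is_state d w" and Pw: "P *\<^sub>v w = 0\<^sub>v d"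
  shows "projector d (P + ket_bra w w)"
proof -
  let ?K = "ket_bra w w"
  have c [simp]: "P \<in> carrier_mat d d" "w \<in> carrier_vec d" "?K \<in> carrier_mat d d"
    using P is_state_carrier[OF w] by (auto simp: projector_def)
  have z: "ket_bra w (0\<^sub>v d) = 0\<^sub>m d d" "ket_bra (0\<^sub>v d) w = 0\<^sub>m d d"
    by (rule eq_matI; simp add: ket_bra_def carrier_vecD[OF c(2)])+
  have "P * ?K = 0\<^sub>m d d"
    using mult_ket_bra[of P d d w w d] Pw z by simp
  moreover have "?K * P = 0\<^sub>m d d"
    using ket_bra_mult_dag[of P d d w d w] Pw z P by (simp add: projector_def)
  moreover have "?K * ?K = ?K"
  proof -
    have "?K *\<^sub>v w = w"
      using is_state_braket[OF w] by (subst ket_bra_mult_vec[of _ d _ d]) auto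
    then show ?thesis
      using mult_ket_bra[of ?K d d w w d] by simp
  qed
  moreover have "(P + ?K) * (P + ?K) = (P * P + P * ?K) + (?K * P + ?K * ?K)"
    using add_mult_distrib_mat[of P d d ?K "P + ?K" d] mult_add_distrib_mat[of P d d P d ?K]
      mult_add_distrib_mat[of ?K d d P d ?K] by simp
  ultimately have "(P + ?K) * (P + ?K) = P + ?K"
    using P by (simp add: projector_def)
  then show ?thesis
    using P by (simp add: projector_def dag_add[of _ d d])
qed

lemma projector_mult_mult_vec:
  assumes "projector d P" "v \<in> carrier_vec d"
  shows "P *\<^sub>v (P *\<^sub>v v) = P *\<^sub>v v"
  using assms assoc_mult_mat_vec[of P d d P d v] by (simp add: projector_def)

text \<open>Gram-Schmidt by induction on \<open>T\<close>: the part of the new vector that the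
  projector misses is normalized and contributes a rank-one summand. The last conclusion bounds the
  range, so that together with the second one \<open>P\<close> is the projector onto the
  span.\<close>

lemma finite_span_projector:
  assumes "finite T" "T \<subseteq> carrier_vec d"
  obtains P where "projector d P" "\<And>t. t \<in> T \<Longrightarrow> P *\<^sub>v t = t"
    "\<And>v. v \<in> carrier_vec d \<Longrightarrow> P *\<^sub>v v \<in> cspan d T"
proof -
  have "\<exists>P. projector d P \<and> (\<forall>t\<in>T. P *\<^sub>v t = t) \<and> (\<forall>v\<in>carrier_vec d. P *\<^sub>v v \<in> cspan d T)"
    using assms
  proof (induction T rule: finite_induct)
    case empty
    have "0\<^sub>m d d *\<^sub>v v = (0\<^sub>v d :: complex vec)" if "v \<in> carrier_vec d" for v
      using that by (intro eq_vecI) auto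
    moreover have "0\<^sub>v d \<in> cspan d {}"
    proof -
      interpret vec_space "TYPE(complex)" d .
      show ?thesis
        using span_zero by simp
    qed
    moreover have "dag (0\<^sub>m d d) = 0\<^sub>m d d"
      by (intro eq_matI) auto
    ultimately show ?case
      by (intro exI[of _ "0\<^sub>m d d"]) (auto simp: projector_def)
  next
    case (insert x T)
    then obtain P where P: "projector d P" "\<And>t. t \<in> T \<Longrightarrow> P *\<^sub>v t = t"
        "\<And>v. v \<in> carrier_vec d \<Longrightarrow> P *\<^sub>v v \<in> cspan d T"
      by auto
    have x: "x \<in> carrier_vec d" "T \<subseteq> carrier_vec d"
      using insert by auto
    have Pc: "P \<in> carrier_mat d d" "dag P = P"
      using P by (auto simp: projector_def)
    have Pvc: "P *\<^sub>v v \<in> carrier_vec d" if "v \<in> carrier_vec d" for v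
      using Pc that by (auto intro: mult_mat_vec_carrier)
    have sub: "cspan d T \<subseteq> cspan d (insert x T)"
      by (intro cspan_mono) auto
    define y where "y = x - P *\<^sub>v x"
    have y: "y \<in> carrier_vec d"
      using x Pvc by (simp add: y_def)
    have xy: "P *\<^sub>v x + y = x"
      using add_diff_cancel_vec[OF Pvc[OF x(1)] x(1)] by (simp add: y_def)
    show ?case
    \<comment> \<open>A vanishing residual means that \<open>x\<close> is already fixed and the old
      projector can be kept.\<close>
    proof (cases "y = 0\<^sub>v d")
      case True
      then have "P *\<^sub>v x = x"
        using xy Pvc[OF x(1)] by simp
      then show ?thesis
        using P sub by blast
    next
      case False
      then obtain c where w: "is_state d (c \<cdot>\<^sub>v y)" and c: "c \<noteq> 0"
        using normalize_to_state[OF y] by blast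
      define w where "w = c \<cdot>\<^sub>v y"
      have wc: "w \<in> carrier_vec d"
        using y by (simp add: w_def)
      have "P *\<^sub>v y = 0\<^sub>v d"
        unfolding y_def using x Pc Pvc projector_mult_mult_vec[OF P(1) x(1)]
        by (simp add: mult_minus_distrib_mat_vec[of _ d d])
      then have Pw: "P *\<^sub>v w = 0\<^sub>v d"
        unfolding w_def using y Pc by (auto simp: mult_mat_vec[of _ d d])
      let ?Q = "P + ket_bra w w"
      have Q: "?Q *\<^sub>v v = P *\<^sub>v v + braket w v \<cdot>\<^sub>v w" if "v \<in> carrier_vec d" for v
        using that wc Pc by (simp add: add_mult_distrib_mat_vec[of _ d d] ket_bra_mult_vec[of _ d _ d])
      have wP: "braket w (P *\<^sub>v v) = 0" if "v \<in> carrier_vec d" for v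
        using that wc Pc Pw by (simp add: braket_mult_mat_vec[of _ d d])
      have "?Q *\<^sub>v t = t" if t: "t \<in> T" for t
      proof -
        have "t \<in> carrier_vec d"
          using t x by auto
        then show ?thesis
          using Q[of t] wP[of t] P(2)[OF t] wc by (auto intro!: eq_vecI)
      qed
      moreover have "?Q *\<^sub>v x = x"
      proof -
        have "braket w x = braket w (P *\<^sub>v x) + braket w y"
          using xy wc y x Pvc braket_add_right[of w d "P *\<^sub>v x" y] by simp
        also have "\<dots> = braket w y"
          using wP x by simp
        \<comment> \<open>Here \<open>1 = braket w w = c * braket w y\<close>, as \<open>w\<close>
          is \<open>y\<close> scaled by \<open>c\<close>. The rank-one part applied to
          \<open>x\<close> therefore returns exactly the residual \<open>y\<close>.\<close>
        finally have "c * braket w x = 1"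
          using w braket_smult_right[OF wc y, of c] unfolding w_def[symmetric] is_state_def by simp
        then have "braket w x \<cdot>\<^sub>v w = y"
          using y unfolding w_def by (intro eq_vecI) (auto simp: mult_ac)
        then show ?thesis
          using Q[OF x(1)] xy by simp
      qed
      moreover have "?Q *\<^sub>v v \<in> cspan d (insert x T)" if v: "v \<in> carrier_vec d" for v
      proof -
        have ins: "insert x T \<subseteq> carrier_vec d"
          using x by auto
        have "x \<in> cspan d (insert x T)"
          using cspan_superset[OF ins] by auto
        moreover have "P *\<^sub>v u \<in> cspan d (insert x T)" if "u \<in> carrier_vec d" for u
          using P(3)[OF that] sub by auto
        ultimately have "w \<in> cspan d (insert x T)"
          unfolding w_def y_def using x by (intro cspan_closed[OF ins]) auto
        then show ?thesis
          unfolding Q[OF v] using P(3)[OF v] sub by (intro cspan_closed[OF ins]) auto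
      qed
      moreover have "projector d ?Q"
        using P(1) w Pw unfolding w_def by (rule projector_add_ket_bra)
      ultimately show ?thesis
        by (intro exI[of _ ?Q]) auto
    qed
  qed
  then show thesis
    using that by blast
qed

text \<open>\<open>S\<close> may be infinite, so the projector is built from a finite maximal
  independent subset. A vector \<open>v\<close> orthogonal to \<open>S\<close> is annihilated
  because \<open>braket (P v) (P v) = braket v (P v)\<close> and \<open>P v\<close> lies in the
  span. The last conclusion is how triviality of the projector is later turned into
  spanning.\<close>

lemma span_projector:
  assumes "S \<subseteq> carrier_vec d"
  obtains P where "projector d P" "\<And>s. s \<in> S \<Longrightarrow> P *\<^sub>v s = s"
    "\<And>v. \<lbrakk>v \<in> carrier_vec d; \<And>s. s \<in> S \<Longrightarrow> braket s v = 0\<rbrakk> \<Longrightarrow> P *\<^sub>v v = 0\<^sub>v d"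
    "P = 1\<^sub>m d \<Longrightarrow> spans d S"
proof -
  obtain T where T: "T \<subseteq> S" "cindep d T" "finite T" "\<And>v. v \<in> S \<Longrightarrow> v \<in> cspan d T"
    using maximal_cindep[of S d "{}" "\<lambda>_. True"] assms cindep_empty by auto
  have Tc: "T \<subseteq> carrier_vec d"
    using T assms by auto
  obtain P where P: "projector d P" "\<And>t. t \<in> T \<Longrightarrow> P *\<^sub>v t = t"
      "\<And>v. v \<in> carrier_vec d \<Longrightarrow> P *\<^sub>v v \<in> cspan d T"
    using finite_span_projector[OF T(3) Tc] by blast
  have Pc: "P \<in> carrier_mat d d" "dag P = P"
    using P by (auto simp: projector_def)
  show thesis
  proof (rule that[OF P(1)])
    fix s
    assume "s \<in> S"
    then have "s \<in> cspan d T"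
      using T by auto
    then show "P *\<^sub>v s = s"
      using Tc
    proof (induction s rule: cspan_induct)
      case (add u v)
      then show ?case
        using Pc by (simp add: mult_add_distrib_mat_vec[of _ d d])
    next
      case (smult c v)
      then show ?case
        using Pc by (simp add: mult_mat_vec[of _ d d])
    qed (use P Pc in \<open>auto intro!: eq_vecI\<close>)
  next
    fix v
    assume v: "v \<in> carrier_vec d" and orth: "\<And>s. s \<in> S \<Longrightarrow> braket s v = 0"
    have Pv: "P *\<^sub>v v \<in> carrier_vec d"
      using Pc v by (auto intro: mult_mat_vec_carrier)
    have "braket v t = 0" if "t \<in> T" for t
      using orth[of t] that T(1) Tc v braket_eq_0_commute[of v d t] by auto
    then have "braket v (P *\<^sub>v v) = 0"
      using braket_cspan_eq_0[OF P(3)[OF v] Tc v] by auto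
    moreover have "braket (P *\<^sub>v v) (P *\<^sub>v v) = braket v (P *\<^sub>v v)"
      using Pc v Pv projector_mult_mult_vec[OF P(1) v] braket_mult_mat_vec[of P d d v "P *\<^sub>v v"] by simp
    ultimately show "P *\<^sub>v v = 0\<^sub>v d"
      using braket_self_eq_0[OF Pv] by simp
  next
    assume "P = 1\<^sub>m d"
    then have "carrier_vec d \<subseteq> cspan d T"
      using P(3) by auto
    then have "carrier_vec d \<subseteq> cspan d S"
      using cspan_mono[OF T(1), of d] by auto
    then show "spans d S"
      using cspan_carrier[OF assms] assms by (auto simp: spans_def)
  qed
qed

subsection \<open>Channels and identification sets\<close>

lemma Re_sum_list: "Re (\<Sum>x\<leftarrow>xs. f x) = (\<Sum>x\<leftarrow>xs. Re (f x))"
  by (induction xs) auto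

lemma mult_carrier_square [simp]:
  "A \<in> carrier_mat d d \<Longrightarrow> B \<in> carrier_mat d d \<Longrightarrow> A * B \<in> carrier_mat d d"
  by (rule mult_carrier_mat)

lemma mtrace_msum_map:
  assumes "\<And>x. x \<in> set xs \<Longrightarrow> f x \<in> carrier_mat d d"
  shows "mtrace (msum d (map f xs)) = (\<Sum>x\<leftarrow>xs. mtrace (f x))"
  using mtrace_msum[of "map f xs" d] assms by (force simp: comp_def)

lemma mult_msum_map:
  assumes "\<And>x. x \<in> set xs \<Longrightarrow> f x \<in> carrier_mat d d" "B \<in> carrier_mat d d"
  shows "B * msum d (map f xs) = msum d (map (\<lambda>x. B * f x) xs)"
  using mult_msum[of "map f xs" d B] assms by (force simp: comp_def)

lemma braket_msum_map:
  assumes "\<And>x. x \<in> set xs \<Longrightarrow> f x \<in> carrier_mat d d" "u \<in> carrier_vec d" "v \<in> carrier_vec d"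
  shows "braket u (msum d (map f xs) *\<^sub>v v) = (\<Sum>x\<leftarrow>xs. braket u (f x *\<^sub>v v))"
  using braket_msum_mult_vec[of "map f xs" d u v] assms by (force simp: comp_def)

lemma msum_map_carrier:
  assumes "\<And>x. x \<in> set xs \<Longrightarrow> f x \<in> carrier_mat d d"
  shows "msum d (map f xs) \<in> carrier_mat d d"
  using assms by (intro msum_carrier) auto

lemma index_msum_map:
  assumes "\<And>x. x \<in> set xs \<Longrightarrow> f x \<in> carrier_mat d d" "i < d" "j < d"
  shows "msum d (map f xs) $$ (i, j) = (\<Sum>x\<leftarrow>xs. f x $$ (i, j))"
  using index_msum[of "map f xs" d i j] assms by (force simp: comp_def)

lemma is_channel_carrier: "is_channel d Ks \<Longrightarrow> K \<in> set Ks \<Longrightarrow> K \<in> carrier_mat d d"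
  by (auto simp: is_channel_def)

text \<open>Trace preservation in polarized form. Allowing two different vectors is essential: the
  overlap of two inputs is what ties together the coefficients at both of them.\<close>

lemma channel_braket:
  assumes Ks: "is_channel d Ks" and uv: "u \<in> carrier_vec d" "v \<in> carrier_vec d"
  shows "(\<Sum>K\<leftarrow>Ks. braket (K *\<^sub>v u) (K *\<^sub>v v)) = braket u v"
proof -
  have "braket u v = braket u (msum d (map (\<lambda>K. dag K * K) Ks) *\<^sub>v v)"
    using Ks uv by (simp add: is_channel_def)
  also have "\<dots> = (\<Sum>K\<leftarrow>Ks. braket u ((dag K * K) *\<^sub>v v))"
  proof -
    have "dag K * K \<in> carrier_mat d d" if "K \<in> set Ks" for K
      using is_channel_carrier[OF Ks that] dag_carrier[OF is_channel_carrier[OF Ks that]] by simp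
    then show ?thesis
      using uv by (intro braket_msum_map)
  qed
  also have "\<dots> = (\<Sum>K\<leftarrow>Ks. braket (K *\<^sub>v u) (K *\<^sub>v v))"
  proof (intro arg_cong[of _ _ sum_list] map_cong refl)
    fix K
    assume "K \<in> set Ks"
    then have K: "K \<in> carrier_mat d d"
      by (rule is_channel_carrier[OF Ks])
    then have "(dag K * K) *\<^sub>v v = dag K *\<^sub>v (K *\<^sub>v v)"
      using uv by (intro assoc_mult_mat_vec[of _ d d]) auto
    moreover have "K *\<^sub>v v \<in> carrier_vec d"
      using K uv by simp
    ultimately show "braket u ((dag K * K) *\<^sub>v v) = braket (K *\<^sub>v u) (K *\<^sub>v v)"
      using K uv braket_mult_mat_vec[of "dag K" d d u "K *\<^sub>v v"] by simp
  qed
  finally show ?thesis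
    by simp
qed

lemma kraus_ket_bra:
  assumes "K \<in> carrier_mat d d" "u \<in> carrier_vec d" "v \<in> carrier_vec d"
  shows "K * ket_bra u v * dag K = ket_bra (K *\<^sub>v u) (K *\<^sub>v v)"
proof -
  have "K *\<^sub>v u \<in> carrier_vec d"
    using assms by simp
  then show ?thesis
    using assms mult_ket_bra[of K d d u v d] ket_bra_mult_dag[of K d d "K *\<^sub>v u" d v] by simp
qed

text \<open>Writes a pass probability as a sum of quadratic forms over the Kraus operators, which
  can be compared termwise with \<open>channel_braket\<close> for \<open>u = v\<close>.\<close>

lemma mtrace_apply_channel:
  assumes Ks: "is_channel d Ks" and T: "T \<in> carrier_mat d d" and v: "v \<in> carrier_vec d"
  shows "mtrace (T * apply_channel d Ks (ket_bra v v)) = (\<Sum>K\<leftarrow>Ks. braket (K *\<^sub>v v) (T *\<^sub>v (K *\<^sub>v v)))"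
proof -
  have Kv: "K *\<^sub>v v \<in> carrier_vec d" if "K \<in> set Ks" for K
    using is_channel_carrier[OF Ks that] v by simp
  have KK: "ket_bra (K *\<^sub>v v) (K *\<^sub>v v) \<in> carrier_mat d d" if "K \<in> set Ks" for K
    using Kv[OF that] Kv[OF that] by (rule ket_bra_carrier)
  have TK: "T *\<^sub>v (K *\<^sub>v v) \<in> carrier_vec d" if "K \<in> set Ks" for K
    using T Kv[OF that] by simp
  have eq: "map (\<lambda>K. K * ket_bra v v * dag K) Ks = map (\<lambda>K. ket_bra (K *\<^sub>v v) (K *\<^sub>v v)) Ks"
    by (intro map_cong refl kraus_ket_bra[of _ d] is_channel_carrier[OF Ks] v)
  have "mtrace (T * apply_channel d Ks (ket_bra v v))
      = mtrace (msum d (map (\<lambda>K. T * ket_bra (K *\<^sub>v v) (K *\<^sub>v v)) Ks))"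
    unfolding apply_channel_def eq by (subst mult_msum_map[of Ks _ d T]) (use KK T in auto)
  also have "\<dots> = mtrace (msum d (map (\<lambda>K. ket_bra (T *\<^sub>v (K *\<^sub>v v)) (K *\<^sub>v v)) Ks))"
    by (simp add: mult_ket_bra[OF T Kv Kv] cong: map_cong)
  also have "\<dots> = (\<Sum>K\<leftarrow>Ks. mtrace (ket_bra (T *\<^sub>v (K *\<^sub>v v)) (K *\<^sub>v v)))"
    by (rule mtrace_msum_map) (rule ket_bra_carrier[OF TK Kv])
  also have "\<dots> = (\<Sum>K\<leftarrow>Ks. braket (K *\<^sub>v v) (T *\<^sub>v (K *\<^sub>v v)))"
    by (simp add: mtrace_ket_bra[OF TK Kv] cong: map_cong)
  finally show ?thesis .
qed

lemma unitary_op_braket: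
  assumes "unitary_op d U" "u \<in> carrier_vec d" "v \<in> carrier_vec d"
  shows "braket (U *\<^sub>v u) (U *\<^sub>v v) = braket u v"
proof -
  have U: "U \<in> carrier_mat d d" "dag U * U = 1\<^sub>m d"
    using assms by (auto simp: unitary_op_def)
  have "braket (U *\<^sub>v u) (U *\<^sub>v v) = braket (dag U *\<^sub>v (U *\<^sub>v u)) v"
    using U assms by (intro braket_mult_mat_vec[of _ d d]) auto
  also have "dag U *\<^sub>v (U *\<^sub>v u) = (dag U * U) *\<^sub>v u"
    using U assms by (intro assoc_mult_mat_vec[symmetric, of _ d d _ d]) auto
  finally show ?thesis
    using U assms by simp
qed

lemma unitary_op_is_state:
  assumes "unitary_op d U" "is_state d v"
  shows "is_state d (U *\<^sub>v v)"
proof -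
  have "v \<in> carrier_vec d" "U \<in> carrier_mat d d" "braket v v = 1"
    using assms by (simp_all add: is_state_def unitary_op_def)
  then show ?thesis
    using unitary_op_braket[OF assms(1)] unfolding is_state_def by simp
qed

text \<open>Let \<open>y K\<close> be the component of \<open>K v\<close> orthogonal to
  \<open>w\<close>. The squared norms of all \<open>y K\<close> add up to total probability minus
  pass probability, that is 1 - 1, so each of them vanishes.\<close>

lemma kraus_of_certain_pass:
  assumes Ks: "is_channel d Ks" and v: "is_state d v" and w: "is_state d w"
    and pass: "mtrace (ket_bra w w * apply_channel d Ks (ket_bra v v)) = 1" and K: "K \<in> set Ks"
  shows "K *\<^sub>v v = braket w (K *\<^sub>v v) \<cdot>\<^sub>v w"
proof -
  have c: "v \<in> carrier_vec d" "w \<in> carrier_vec d" "braket w w = 1" "braket v v = 1"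
    using v w by (simp_all add: is_state_def)
  define y where "y K = K *\<^sub>v v - braket w (K *\<^sub>v v) \<cdot>\<^sub>v w" for K
  have Kv: "K *\<^sub>v v \<in> carrier_vec d" if "K \<in> set Ks" for K
    using is_channel_carrier[OF Ks that] c by simp
  have yc: "y K \<in> carrier_vec d" if "K \<in> set Ks" for K
    using Kv[OF that] c by (simp add: y_def)
  have yy: "braket (y K) (y K) = braket (K *\<^sub>v v) (K *\<^sub>v v) - braket (K *\<^sub>v v) (ket_bra w w *\<^sub>v (K *\<^sub>v v))"
    if "K \<in> set Ks" for K
  proof -
    let ?x = "K *\<^sub>v v"
    have "braket w (y K) = 0"
      using Kv[OF that] c by (simp add: y_def braket_diff_right[of _ d] braket_smult_right[of _ d])
    then have "braket (y K) (y K) = braket ?x (y K)"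
      using Kv[OF that] c yc[OF that] unfolding y_def
      by (subst braket_diff_left[of _ d]) (auto simp: braket_smult_left[of _ d])
    also have "\<dots> = braket ?x ?x - braket ?x (braket w ?x \<cdot>\<^sub>v w)"
      using Kv[OF that] c unfolding y_def by (intro braket_diff_right[of _ d]) auto
    also have "braket w ?x \<cdot>\<^sub>v w = ket_bra w w *\<^sub>v ?x"
      using Kv[OF that] c by (simp add: ket_bra_mult_vec[of _ d _ d])
    finally show ?thesis .
  qed
  have "(\<Sum>K\<leftarrow>Ks. braket (y K) (y K))
      = (\<Sum>K\<leftarrow>Ks. braket (K *\<^sub>v v) (K *\<^sub>v v) - braket (K *\<^sub>v v) (ket_bra w w *\<^sub>v (K *\<^sub>v v)))"
    by (intro arg_cong[of _ _ sum_list] map_cong refl yy)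
  also have "\<dots> = 0"
    using channel_braket[OF Ks c(1,1)] mtrace_apply_channel[OF Ks ket_bra_carrier[OF c(2,2)] c(1)] pass c
    by (simp add: sum_list_subtractf)
  finally have "(\<Sum>K\<leftarrow>Ks. Re (braket (y K) (y K))) = 0"
    by (metis Re_sum_list zero_complex.simps(1))
  moreover have "Re (braket (y K) (y K)) \<ge> 0" if "K \<in> set Ks" for K
    using braket_self_real[OF yc[OF that]] by simp
  ultimately have "Re (braket (y K) (y K)) = 0"
    using K by (subst (asm) sum_list_nonneg_eq_0_iff) auto
  then have "braket (y K) (y K) = 0"
    using braket_self_real[OF yc[OF K]] by (simp add: complex_eq_iff)
  then have "y K = 0\<^sub>v d"
    using braket_self_eq_0[OF yc[OF K]] by simp
  then have "braket w (K *\<^sub>v v) \<cdot>\<^sub>v w + 0\<^sub>v d = K *\<^sub>v v"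
    using add_diff_cancel_vec[of "braket w (K *\<^sub>v v) \<cdot>\<^sub>v w" d "K *\<^sub>v v"] Kv[OF K] c by (simp add: y_def)
  then show ?thesis
    using c by simp
qed

lemma apply_channel_scalar_kraus:
  assumes U: "U \<in> carrier_mat d d" and K: "\<And>K. K \<in> set Ks \<Longrightarrow> K = c K \<cdot>\<^sub>m U"
    and norm: "(\<Sum>K\<leftarrow>Ks. cnj (c K) * c K) = 1"
  shows "is_unitary_channel_of d U Ks"
  unfolding is_unitary_channel_of_def
proof
  fix \<rho> :: "complex mat"
  assume \<rho>: "\<rho> \<in> carrier_mat d d"
  have UU: "U * \<rho> * dag U \<in> carrier_mat d d"
    using U \<rho> dag_carrier[OF U] by simp
  have eq: "K * \<rho> * dag K = (cnj (c K) * c K) \<cdot>\<^sub>m (U * \<rho> * dag U)" if "K \<in> set Ks" for K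
  proof -
    have "dag (c K \<cdot>\<^sub>m U) = cnj (c K) \<cdot>\<^sub>m dag U"
      using U by (intro eq_matI) auto
    moreover have "c K \<cdot>\<^sub>m U * \<rho> = c K \<cdot>\<^sub>m (U * \<rho>)"
      using U \<rho> by (intro mult_smult_assoc_mat) auto
    moreover have "c K \<cdot>\<^sub>m (U * \<rho>) * (cnj (c K) \<cdot>\<^sub>m dag U) = c K \<cdot>\<^sub>m (cnj (c K) \<cdot>\<^sub>m (U * \<rho> * dag U))"
      using U \<rho> mult_smult_assoc_mat[of "U * \<rho>" d d "cnj (c K) \<cdot>\<^sub>m dag U" d "c K"]
        mult_smult_distrib[of "U * \<rho>" d d "dag U" d "cnj (c K)"] dag_carrier[OF U] by (simp del: assoc_mult_mat)
    ultimately have "(c K \<cdot>\<^sub>m U) * \<rho> * dag (c K \<cdot>\<^sub>m U) = c K \<cdot>\<^sub>m (cnj (c K) \<cdot>\<^sub>m (U * \<rho> * dag U))"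
      by simp
    also have "\<dots> = (cnj (c K) * c K) \<cdot>\<^sub>m (U * \<rho> * dag U)"
      by (intro eq_matI) auto
    finally show ?thesis
      using K[OF that] by metis
  qed
  have "apply_channel d Ks \<rho> = msum d (map (\<lambda>K. (cnj (c K) * c K) \<cdot>\<^sub>m (U * \<rho> * dag U)) Ks)"
    unfolding apply_channel_def by (intro arg_cong[of _ _ "msum d"] map_cong refl eq)
  also have "\<dots> = U * \<rho> * dag U"
  proof (rule eq_matI)
    fix i j
    assume "i < dim_row (U * \<rho> * dag U)" "j < dim_col (U * \<rho> * dag U)"
    then have ij: "i < d" "j < d"
      using UU by auto
    have "msum d (map (\<lambda>K. (cnj (c K) * c K) \<cdot>\<^sub>m (U * \<rho> * dag U)) Ks) $$ (i, j)
        = (\<Sum>K\<leftarrow>Ks. (cnj (c K) * c K) * (U * \<rho> * dag U) $$ (i, j))"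
      using ij carrier_matD[OF UU] by (subst index_msum_map) (auto simp del: index_mult_mat(1))
    also have "\<dots> = (\<Sum>K\<leftarrow>Ks. cnj (c K) * c K) * (U * \<rho> * dag U) $$ (i, j)"
      by (rule sum_list_mult_const)
    finally show "msum d (map (\<lambda>K. (cnj (c K) * c K) \<cdot>\<^sub>m (U * \<rho> * dag U)) Ks) $$ (i, j) = (U * \<rho> * dag U) $$ (i, j)"
      using norm by simp
  next
    have "msum d (map (\<lambda>K. (cnj (c K) * c K) \<cdot>\<^sub>m (U * \<rho> * dag U)) Ks) \<in> carrier_mat d d"
      using UU by (intro msum_map_carrier) auto
    then show "dim_row (msum d (map (\<lambda>K. (cnj (c K) * c K) \<cdot>\<^sub>m (U * \<rho> * dag U)) Ks)) = dim_row (U * \<rho> * dag U)"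
      "dim_col (msum d (map (\<lambda>K. (cnj (c K) * c K) \<cdot>\<^sub>m (U * \<rho> * dag U)) Ks)) = dim_col (U * \<rho> * dag U)"
      using UU by auto
  qed
  finally show "apply_channel d Ks \<rho> = U * \<rho> * dag U" .
qed

lemma Re_cnj_mult_self: "Re (cnj z * z) = (cmod z)\<^sup>2"
  by (simp add: cmod_power2) (simp add: power2_eq_square)

lemma spans_nonempty:
  assumes "spans d S" "d > 0"
  shows "S \<noteq> {}"
  using spans_imp_card_ge[of d S] assms by auto

text \<open>The hypothesis is certain passing of rank-one tests rather than equality of output
  states, so that the result covers both identification sets and the reliability of a
  protocol.\<close>

theorem certain_pass_imp_unitary_channel:
  assumes U: "unitary_op d U" and d: "d > 0" and S: "connected_spanning_set d S"
    and Ks: "is_channel d Ks"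
    and pass: "\<And>v. v \<in> S \<Longrightarrow> mtrace (ket_bra (U *\<^sub>v v) (U *\<^sub>v v) * apply_channel d Ks (ket_bra v v)) = 1"
  shows "is_unitary_channel_of d U Ks"
proof -
  have Uc: "U \<in> carrier_mat d d"
    using U by (simp add: unitary_op_def)
  have st: "is_state d v" "is_state d (U *\<^sub>v v)" "v \<in> carrier_vec d" "U *\<^sub>v v \<in> carrier_vec d" if "v \<in> S" for v
    using that S unitary_op_is_state[OF U, of v] is_state_carrier[of d]
    by (auto simp: connected_spanning_set_def)
  define c where "c K v = braket (U *\<^sub>v v) (K *\<^sub>v v)" for K v
  have Kv: "K *\<^sub>v v = c K v \<cdot>\<^sub>v (U *\<^sub>v v)" if "K \<in> set Ks" "v \<in> S" for K v
    unfolding c_def using that pass st by (intro kraus_of_certain_pass[OF Ks]) auto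
  \<comment> \<open>Each Kraus operator multiplies the overlap of \<open>a\<close> and
    \<open>b\<close> by one product of coefficients. Since the total overlap is preserved and
    nonzero, it can be cancelled.\<close>
  have sum1: "(\<Sum>K\<leftarrow>Ks. cnj (c K a) * c K b) = 1" if ab: "a \<in> S" "b \<in> S" "braket a b \<noteq> 0" for a b
  proof -
    have "braket (K *\<^sub>v a) (K *\<^sub>v b) = (cnj (c K a) * c K b) * braket a b" if "K \<in> set Ks" for K
      using st[OF ab(1)] st[OF ab(2)] unitary_op_braket[OF U, of a b]
      unfolding Kv[OF that ab(1)] Kv[OF that ab(2)]
      by (simp add: braket_smult_left[of _ d] braket_smult_right[of _ d])
    then have "(\<Sum>K\<leftarrow>Ks. (cnj (c K a) * c K b) * braket a b) = braket a b"
      using channel_braket[OF Ks, of a b] st ab by (simp cong: map_cong)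
    then have "(\<Sum>K\<leftarrow>Ks. cnj (c K a) * c K b) * braket a b = braket a b"
      by (simp add: sum_list_mult_const)
    then show ?thesis
      using ab by simp
  qed
  have adj: "c K a = c K b" if ab: "a \<in> S" "b \<in> S" "braket a b \<noteq> 0" and K: "K \<in> set Ks" for a b K
  proof -
    have ba: "braket b a \<noteq> 0"
      using braket_eq_0_commute[of a d b] st ab by auto
    have aa: "braket a a \<noteq> 0" "braket b b \<noteq> 0"
      using is_state_braket[OF st(1)[OF ab(1)]] is_state_braket[OF st(1)[OF ab(2)]] by auto
    \<comment> \<open>The squared distance of the two coefficient vectors expands into four inner
      products, each equal to 1 by \<open>sum1\<close>, with signs that cancel.\<close>
    have "(\<Sum>K\<leftarrow>Ks. cnj (c K a - c K b) * (c K a - c K b))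
        = (\<Sum>K\<leftarrow>Ks. (cnj (c K a) * c K a - cnj (c K a) * c K b) - (cnj (c K b) * c K a - cnj (c K b) * c K b))"
      by (intro arg_cong[of _ _ sum_list] map_cong refl) (simp add: algebra_simps)
    also have "\<dots> = 0"
      using sum1[OF ab(1,2,3)] sum1[OF ab(2,1) ba] sum1[OF ab(1,1) aa(1)] sum1[OF ab(2,2) aa(2)]
      by (simp add: sum_list_subtractf)
    finally have "(\<Sum>K\<leftarrow>Ks. Re (cnj (c K a - c K b) * (c K a - c K b))) = 0"
      by (metis Re_sum_list zero_complex.simps(1))
    then have "(\<Sum>K\<leftarrow>Ks. (cmod (c K a - c K b))\<^sup>2) = 0"
      by (simp only: Re_cnj_mult_self)
    then have "(cmod (c K a - c K b))\<^sup>2 = 0"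
      using K by (subst (asm) sum_list_nonneg_eq_0_iff) auto
    then show ?thesis
      by simp
  qed
  obtain x where x: "x \<in> S"
    using spans_nonempty[of d S] d S by (auto simp: connected_spanning_set_def)
  have const: "c K x = c K v" if K: "K \<in> set Ks" and v: "v \<in> S" for K v
  proof -
    have "(x, v) \<in> (transition_edges S)\<^sup>*"
      using S x v by (auto simp: connected_spanning_set_def connected_set_def)
    then show ?thesis
      by (induction rule: rtrancl_induct) (auto simp: transition_edges_def dest: adj[OF _ _ _ K])
  qed
  show ?thesis
  proof (rule apply_channel_scalar_kraus[OF Uc])
    fix K
    assume K: "K \<in> set Ks"
    have Kc: "K \<in> carrier_mat d d"
      using is_channel_carrier[OF Ks K] .
    show "K = c K x \<cdot>\<^sub>m U"
    proof (rule eq_mat_on_spanning[OF Kc])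
      fix v
      assume v: "v \<in> S"
      have "c K x \<cdot>\<^sub>v (U *\<^sub>v v) = (c K x \<cdot>\<^sub>m U) *\<^sub>v v"
        using Uc st(3)[OF v] by (intro eq_vecI) auto
      then show "K *\<^sub>v v = (c K x \<cdot>\<^sub>m U) *\<^sub>v v"
        using Kv[OF K v] const[OF K v] by simp
    qed (use Uc S in \<open>auto simp: connected_spanning_set_def\<close>)
  next
    show "(\<Sum>K\<leftarrow>Ks. cnj (c K x) * c K x) = 1"
      using sum1[OF x x] is_state_braket[OF st(1)[OF x]] by simp
  qed
qed

lemma connected_spanning_is_IS:
  assumes "unitary_op (hdim dims) U" "hdim dims > 0" "connected_spanning_set (hdim dims) S"
  shows "is_IS dims U S"
  unfolding is_IS_def
proof (intro conjI allI impI)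
  show "\<forall>v\<in>S. is_state (hdim dims) v"
    using assms(3) by (simp add: connected_spanning_set_def)
  fix Ks
  assume Ks: "is_channel (hdim dims) Ks"
    and app: "\<forall>v\<in>S. apply_channel (hdim dims) Ks (ket_bra v v) = ket_bra (U *\<^sub>v v) (U *\<^sub>v v)"
  show "is_unitary_channel_of (hdim dims) U Ks"
  proof (rule certain_pass_imp_unitary_channel[OF assms Ks])
    fix v
    assume v: "v \<in> S"
    let ?w = "U *\<^sub>v v"
    have "is_state (hdim dims) ?w"
      using v assms unitary_op_is_state by (auto simp: connected_spanning_set_def)
    then have w: "?w \<in> carrier_vec (hdim dims)" "braket ?w ?w = 1"
      by (simp_all add: is_state_def)
    have "ket_bra ?w ?w * ket_bra ?w ?w = ket_bra (ket_bra ?w ?w *\<^sub>v ?w) ?w"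
      by (rule mult_ket_bra[OF ket_bra_carrier[OF w(1) w(1)] w(1) w(1)])
    also have "ket_bra ?w ?w *\<^sub>v ?w = ?w"
      using ket_bra_mult_vec[OF w(1) w(1) w(1)] w(2) by simp
    finally show "mtrace (ket_bra ?w ?w * apply_channel (hdim dims) Ks (ket_bra v v)) = 1"
      using app v mtrace_ket_bra[OF w(1) w(1)] w(2) by simp
  qed
qed

section \<open>Identification sets are connected and spanning\<close>

lemma projector_mult_vec_carrier:
  assumes "projector d P" "v \<in> carrier_vec d"
  shows "P *\<^sub>v v \<in> carrier_vec d"
  using assms by (auto simp: projector_def intro: mult_mat_vec_carrier)

text \<open>The reflection \<open>2 P - 1\<close> acts trivially on the density matrices of all states that lie in the
  range or in the kernel of \<open>P\<close>.\<close>

lemma IS_trivial_projector: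
  assumes U: "unitary_op (hdim dims) U" and IS: "is_IS dims U S" and P: "projector (hdim dims) P"
    and S: "\<And>v. v \<in> S \<Longrightarrow> P *\<^sub>v v = v \<or> P *\<^sub>v v = 0\<^sub>v (hdim dims)"
    and x: "x \<in> carrier_vec (hdim dims)" "P *\<^sub>v x = x" "x \<noteq> 0\<^sub>v (hdim dims)"
  shows "P = 1\<^sub>m (hdim dims)"
proof -
  define d where "d = hdim dims"
  note U = U[folded d_def] and P = P[folded d_def] and S = S[folded d_def] and x = x[folded d_def]
  have Pc: "P \<in> carrier_mat d d" "dag P = P" "P * P = P"
    using P by (auto simp: projector_def)
  have Uc: "U \<in> carrier_mat d d" "dag U * U = 1\<^sub>m d"
    using U by (auto simp: unitary_op_def)
  define R where "R = P - (1\<^sub>m d - P)"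
  have Rc: "R \<in> carrier_mat d d"
    using Pc by (simp add: R_def minus_carrier_mat)
  have Rv: "R *\<^sub>v v = P *\<^sub>v v - (v - P *\<^sub>v v)" if "v \<in> carrier_vec d" for v
    using Pc that minus_mult_distrib_mat_vec[of P d d "1\<^sub>m d - P" v] minus_mult_distrib_mat_vec[of "1\<^sub>m d" d d P v]
    unfolding R_def by (simp add: minus_carrier_mat)
  have dagR: "dag R = R"
    using Pc dag_diff[of P d d "1\<^sub>m d - P"] dag_diff[of "1\<^sub>m d" d d P] unfolding R_def by (simp add: minus_carrier_mat)
  have PRv: "P *\<^sub>v (R *\<^sub>v v) = P *\<^sub>v v" if v: "v \<in> carrier_vec d" for v
    using Pc(1) v projector_mult_vec_carrier[OF P v]
    by (auto simp: Rv mult_minus_distrib_mat_vec[of _ d d] projector_mult_mult_vec[OF P v] intro!: eq_vecI)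
  have RR: "R * R = 1\<^sub>m d"
  proof (rule eq_mat_on_vecs[of _ d d])
    fix v :: "complex vec"
    assume v: "v \<in> carrier_vec d"
    have RvC: "R *\<^sub>v v \<in> carrier_vec d" and PvC: "P *\<^sub>v v \<in> carrier_vec d"
      using Rc v projector_mult_vec_carrier[OF P v] by auto
    have "(R * R) *\<^sub>v v = R *\<^sub>v (R *\<^sub>v v)"
      using Rc v by (intro assoc_mult_mat_vec[of _ d d]) auto
    also have "\<dots> = P *\<^sub>v v - (R *\<^sub>v v - P *\<^sub>v v)"
      using Rv[OF RvC] PRv[OF v] by simp
    also have "\<dots> = v"
      unfolding Rv[OF v] using PvC v carrier_vecD[OF PvC] by (intro eq_vecI) (auto simp del: dim_mult_mat_vec index_mult_mat_vec)
    finally show "(R * R) *\<^sub>v v = 1\<^sub>m d *\<^sub>v v"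
      using v by simp
  qed (use Rc in auto)
  \<comment> \<open>\<open>R\<close> is a self-adjoint involution, so \<open>U * R\<close> is
    unitary and forms a channel as a single Kraus operator.\<close>
  let ?K = "U * R"
  have Kc: "?K \<in> carrier_mat d d"
    using Uc(1) Rc by (rule mult_carrier_square)
  have Kv: "?K *\<^sub>v v = U *\<^sub>v (R *\<^sub>v v)" if "v \<in> carrier_vec d" for v
    using Uc Rc that by (intro assoc_mult_mat_vec[of _ d d]) auto
  have "dag ?K * ?K = R * (dag U * (U * R))"
    using Uc Rc dag_carrier[OF Uc(1)] dagR
    by (simp add: dag_mult[of _ d d _ d] assoc_mult_mat[of _ d d _ d _ d])
  also have "dag U * (U * R) = R"
    using assoc_mult_mat[of "dag U" d d U d R d] Uc Rc dag_carrier[OF Uc(1)] by simp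
  also note RR
  finally have chan: "is_channel d [?K]"
    using Kc by (simp add: is_channel_def)
  have app: "apply_channel d [?K] (ket_bra u v) = ket_bra (?K *\<^sub>v u) (?K *\<^sub>v v)"
    if "u \<in> carrier_vec d" "v \<in> carrier_vec d" for u v
    using kraus_ket_bra[OF Kc that] Kc that
      ket_bra_carrier[of "?K *\<^sub>v u" d "?K *\<^sub>v v" d] mult_mat_vec_carrier[OF Kc] unfolding apply_channel_def by simp
  have "apply_channel d [?K] (ket_bra v v) = ket_bra (U *\<^sub>v v) (U *\<^sub>v v)" if v: "v \<in> S" for v
  proof -
    have vc: "v \<in> carrier_vec d"
      using IS v by (auto simp: is_IS_def d_def is_state_def)
    have "v - (v - v) = v" "0\<^sub>v d - (v - 0\<^sub>v d) = - v"
      using vc by (auto intro!: eq_vecI)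
    then consider "R *\<^sub>v v = v" | "R *\<^sub>v v = - v"
      using S[OF v] Rv[OF vc] by auto
    then show ?thesis
    proof cases
      case 1
      then show ?thesis
        using app[OF vc vc] Kv[OF vc] by simp
    next
      case 2
      have "U *\<^sub>v (- v) = - (U *\<^sub>v v)"
        using Uc vc by (intro eq_vecI) auto
      moreover have "ket_bra (- w) (- w) = ket_bra w w" for w
        by (intro eq_matI) (auto simp: ket_bra_def)
      ultimately show ?thesis
        using app[OF vc vc] Kv[OF vc] 2 by simp
    qed
  qed
  then have uni: "\<And>\<rho>. \<rho> \<in> carrier_mat d d \<Longrightarrow> apply_channel d [?K] \<rho> = U * \<rho> * dag U"
    using IS chan unfolding is_IS_def is_unitary_channel_of_def d_def by blast
  show ?thesis
  proof (rule ccontr)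
    assume "P \<noteq> 1\<^sub>m (hdim dims)"
    then obtain z where z: "z \<in> carrier_vec d" "P *\<^sub>v z \<noteq> z"
      using eq_mat_on_vecs[of P d d "1\<^sub>m d"] Pc by (auto simp: d_def)
    \<comment> \<open>If \<open>P\<close> is not the identity, both eigenspaces of the reflection
      are nonzero: \<open>x\<close> is fixed and \<open>y\<close> changes sign. The off-diagonal
      operator \<open>ket_bra x y\<close> then changes sign under the reflection, whereas the
      unitary channel of \<open>U\<close> would leave no such sign. Applying both versions to
      \<open>U y\<close> and pairing with \<open>U x\<close> gives the contradiction.\<close>
    define y where "y = z - P *\<^sub>v z"
    have Pz: "P *\<^sub>v z \<in> carrier_vec d"
      using projector_mult_vec_carrier[OF P z(1)] .
    have yc: "y \<in> carrier_vec d"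
      using z Pz by (simp add: y_def)
    have Py: "P *\<^sub>v y = 0\<^sub>v d"
      using Pc z Pz projector_mult_mult_vec[OF P z(1)] unfolding y_def
      by (simp add: mult_minus_distrib_mat_vec[of _ d d])
    have y0: "y \<noteq> 0\<^sub>v d"
    proof
      assume "y = 0\<^sub>v d"
      then show False
        using add_diff_cancel_vec[OF Pz z(1)] z Pz by (simp add: y_def)
    qed
    have Rx: "R *\<^sub>v x = x"
      using Rv[OF x(1)] x by (auto intro!: eq_vecI)
    have Ry: "R *\<^sub>v y = - y"
      using Rv[OF yc] Py yc by (auto intro!: eq_vecI)
    have Uy: "U *\<^sub>v (- y) = - (U *\<^sub>v y)"
      using Uc yc by (intro eq_vecI) auto
    have c: "U *\<^sub>v x \<in> carrier_vec d" "U *\<^sub>v y \<in> carrier_vec d"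
      using Uc x yc by auto
    have "ket_bra (U *\<^sub>v x) (- (U *\<^sub>v y)) = ket_bra (U *\<^sub>v x) (U *\<^sub>v y)"
      using uni[OF ket_bra_carrier[OF x(1) yc]] app[OF x(1) yc] kraus_ket_bra[OF Uc(1) x(1) yc]
        Kv[OF x(1)] Kv[OF yc] Rx Ry Uy by simp
    then have "ket_bra (U *\<^sub>v x) (- (U *\<^sub>v y)) *\<^sub>v (U *\<^sub>v y) = ket_bra (U *\<^sub>v x) (U *\<^sub>v y) *\<^sub>v (U *\<^sub>v y)"
      by simp
    moreover have "- (U *\<^sub>v y) = (- 1) \<cdot>\<^sub>v (U *\<^sub>v y)"
      by (intro eq_vecI) auto
    then have "braket (- (U *\<^sub>v y)) (U *\<^sub>v y) = - braket y y"
      using braket_smult_left[OF c(2) c(2), of "- 1"] unitary_op_braket[OF U yc yc] by simp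
    moreover have "- (U *\<^sub>v y) \<in> carrier_vec d"
      using c by simp
    ultimately have eq: "(- braket y y) \<cdot>\<^sub>v (U *\<^sub>v x) = braket y y \<cdot>\<^sub>v (U *\<^sub>v x)"
      using ket_bra_mult_vec[OF c(1) _ c(2), of "- (U *\<^sub>v y)"] ket_bra_mult_vec[OF c(1) c(2) c(2)]
        unitary_op_braket[OF U yc yc] by metis
    have "(- braket y y) * braket x x = braket y y * braket x x"
      using arg_cong[OF eq, of "braket (U *\<^sub>v x)"] unitary_op_braket[OF U x(1) x(1)]
      unfolding braket_smult_right[OF c(1) c(1)] by metis
    then have "braket y y = 0 \<or> braket x x = 0"
      by auto
    then show False
      using braket_self_eq_0[OF yc] braket_self_eq_0[OF x(1)] y0 x(3) by blast
  qed
qed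

lemma IS_imp_connected_spanning:
  assumes U: "unitary_op (hdim dims) U" and d: "hdim dims \<ge> 2" and IS: "is_IS dims U S"
  shows "connected_spanning_set (hdim dims) S"
proof -
  define d where "d = hdim dims"
  have st: "is_state d v" "v \<in> carrier_vec d" if "v \<in> S" for v
    using IS that by (auto simp: is_IS_def d_def is_state_def)
  \<comment> \<open>The empty set has no component to project onto, so it is excluded separately. As
    \<open>d\<close> is at least 2, the projector onto the first basis vector is a nontrivial
    one.\<close>
  have "S \<noteq> {}"
  proof
    assume "S = {}"
    let ?e = "unit_vec d 0 :: complex vec" and ?f = "unit_vec d 1 :: complex vec"
    have ef: "?e \<in> carrier_vec d" "?f \<in> carrier_vec d" "braket ?e ?e = 1" "braket ?e ?f = 0" "?f \<noteq> 0\<^sub>v d" "?e \<noteq> 0\<^sub>v d"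
      using assms(2) by (auto simp: d_def braket_eq_sum[of _ "hdim dims"] unit_vec_def if_distrib
          if_distribR sum.delta vec_eq_iff cong: if_cong)
    have P: "projector d (ket_bra ?e ?e)"
      using mult_ket_bra[OF ket_bra_carrier[OF ef(1,1)] ef(1,1)] ket_bra_mult_vec[OF ef(1,1,1)] ef
      by (simp add: projector_def)
    have "ket_bra ?e ?e = 1\<^sub>m d"
      using IS_trivial_projector[OF U IS, of "ket_bra ?e ?e" ?e] P ef ket_bra_mult_vec[OF ef(1,1,1)]
        \<open>S = {}\<close> by (simp add: d_def)
    then have "?f = braket ?e ?f \<cdot>\<^sub>v ?e"
      using ket_bra_mult_vec[OF ef(1,1,2)] ef by simp
    then show False
      using ef by auto
  qed
  then obtain x where x: "x \<in> S"
    by blast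
  define C where "C = {y. (x, y) \<in> (transition_edges S)\<^sup>*}"
  have xC: "x \<in> C"
    by (simp add: C_def)
  have CS: "y \<in> S" if "y \<in> C" for y
  proof -
    have "(x, y) \<in> (transition_edges S)\<^sup>*"
      using that by (simp add: C_def)
    then show ?thesis
      by (induction rule: rtrancl_induct) (auto simp: transition_edges_def x)
  qed
  then have Cc: "C \<subseteq> carrier_vec d"
    using st by blast
  obtain P where P: "projector d P" "\<And>s. s \<in> C \<Longrightarrow> P *\<^sub>v s = s"
    "\<And>v. \<lbrakk>v \<in> carrier_vec d; \<And>s. s \<in> C \<Longrightarrow> braket s v = 0\<rbrakk> \<Longrightarrow> P *\<^sub>v v = 0\<^sub>v d"
    "P = 1\<^sub>m d \<Longrightarrow> spans d C"
    using span_projector[OF Cc] by blast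
  have orth: "braket s v = 0" if "s \<in> C" "v \<in> S" "v \<notin> C" for s v
  proof (rule ccontr)
    assume "braket s v \<noteq> 0"
    then have "(s, v) \<in> transition_edges S"
      using that CS by (simp add: transition_edges_def)
    then have "v \<in> C"
      using that unfolding C_def by (auto intro: rtrancl_into_rtrancl)
    then show False
      using that by simp
  qed
  \<comment> \<open>States of the component \<open>C\<close> lie in the range of its projector and
    the remaining ones in the kernel. Triviality of the projector gives both conclusions at once:
    \<open>C\<close> spans, and no state is left outside \<open>C\<close>, since it would be
    annihilated.\<close>
  have 1: "P = 1\<^sub>m d"
    unfolding d_def
  proof (rule IS_trivial_projector[OF U IS])
    show "P *\<^sub>v v = v \<or> P *\<^sub>v v = 0\<^sub>v (hdim dims)" if "v \<in> S" for v
      using P(2)[of v] P(3)[of v] orth[of _ v] st(2)[of v] that unfolding d_def by blast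
    show "x \<in> carrier_vec (hdim dims)" "P *\<^sub>v x = x" "x \<noteq> 0\<^sub>v (hdim dims)"
      using st[OF x] P(2)[OF xC] is_state_nonzero[of d x] unfolding d_def by auto
  qed (use P(1) in \<open>simp add: d_def\<close>)
  have "v \<in> C" if v: "v \<in> S" for v
  proof (rule ccontr)
    assume "v \<notin> C"
    then have "P *\<^sub>v v = 0\<^sub>v d"
      using P(3)[of v] orth[of _ v] st(2)[OF v] v by blast
    then show False
      using 1 st[OF v] is_state_nonzero[of d v] by simp
  qed
  then have CeqS: "C = S"
    using CS by auto
  have "sym (transition_edges S)"
    using st braket_eq_0_commute[of _ d] by (auto simp: sym_def transition_edges_def)
  then have sym: "sym ((transition_edges S)\<^sup>*)"
    by (rule sym_rtrancl)
  have "connected_set S"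
    unfolding connected_set_def
  proof (intro ballI)
    fix a b
    assume "a \<in> S" "b \<in> S"
    then have "(x, a) \<in> (transition_edges S)\<^sup>*" "(x, b) \<in> (transition_edges S)\<^sup>*"
      using CeqS unfolding C_def by auto
    then show "(a, b) \<in> (transition_edges S)\<^sup>*"
      using sym by (meson rtrancl_trans symD)
  qed
  then show ?thesis
    using st P(4)[OF 1] CeqS unfolding connected_spanning_set_def d_def by simp
qed

section \<open>Connected bases and enlargement of connected spanning sets\<close>

lemma connected_set_insert:
  assumes S: "\<And>s. s \<in> insert v T \<Longrightarrow> s \<in> carrier_vec d" and T: "connected_set T"
    and t: "t \<in> T" "braket t v \<noteq> 0"
  shows "connected_set (insert v T)"
proof -
  let ?E = "transition_edges (insert v T)"
  have "transition_edges T \<subseteq> ?E"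
    by (auto simp: transition_edges_def)
  then have TT: "(a, b) \<in> ?E\<^sup>*" if "a \<in> T" "b \<in> T" for a b
    using T that rtrancl_mono[of "transition_edges T" ?E] unfolding connected_set_def by blast
  have tv: "(t, v) \<in> ?E" "(v, t) \<in> ?E"
    using t S braket_eq_0_commute[of t d v] by (auto simp: transition_edges_def)
  have "(a, v) \<in> ?E\<^sup>*" "(v, a) \<in> ?E\<^sup>*" if "a \<in> T" for a
    using TT[OF that t(1)] TT[OF t(1) that] tv
    by (auto intro: rtrancl_into_rtrancl converse_rtrancl_into_rtrancl)
  then show ?thesis
    using TT unfolding connected_set_def by blast
qed

text \<open>For a maximal connected independent subset \<open>T\<close>, membership in the span of
  \<open>T\<close> propagates along the edges of \<open>S\<close>; connectedness of \<open>S\<close>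
  carries it to every state. The invariant is the span and not \<open>T\<close> itself, because a
  path may leave \<open>T\<close>.\<close>

lemma connected_spanning_contains_basis:
  assumes S: "connected_spanning_set d S" and d: "d > 0"
  obtains B where "B \<subseteq> S" "connected_basis d B"
proof -
  have Sc: "S \<subseteq> carrier_vec d" and sp: "spans d S" and st: "\<And>v. v \<in> S \<Longrightarrow> is_state d v"
    using S by (auto simp: connected_spanning_set_def spans_def)
  obtain x where x: "x \<in> S"
    using spans_nonempty[OF sp d] by blast
  have "x \<notin> cspan d {}"
  proof
    assume "x \<in> cspan d {}"
    then have "x = 0\<^sub>v d"
      using empty_subsetI by (induction x rule: cspan_induct) auto
    then show False
      using is_state_nonzero[OF st[OF x]] by simp
  qed
  then have x_indep: "cindep d {x}"
    using cindep_insert[of "{}" d x] cindep_empty x Sc by auto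
  \<comment> \<open>Nonemptiness is included so that \<open>T\<close> supplies a vertex from which
    the paths start.\<close>
  define Q where "Q T \<longleftrightarrow> connected_set T \<and> T \<noteq> {}" for T :: "complex vec set"
  have "Q {x}"
    by (simp add: Q_def connected_set_def)
  obtain T where T0: "T \<subseteq> S" "cindep d T" "Q T" "\<And>v. v \<in> S \<Longrightarrow> Q (insert v T) \<Longrightarrow> v \<in> cspan d T"
    by (rule maximal_cindep[of S d "{x}" Q]) (use Sc x x_indep \<open>Q {x}\<close> in \<open>blast+\<close>)
  have T: "T \<subseteq> S" "cindep d T" "connected_set T \<and> T \<noteq> {}"
    "\<And>v. v \<in> S \<Longrightarrow> connected_set (insert v T) \<Longrightarrow> v \<in> cspan d T"
    using T0 by (simp_all add: Q_def)
  have Tc: "T \<subseteq> carrier_vec d"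
    using T Sc by auto
  \<comment> \<open>If \<open>v\<close> were outside the span, maximality would forbid an edge
    between \<open>v\<close> and any element of \<open>T\<close>. Then \<open>v\<close> would be
    orthogonal to the whole span, in particular to \<open>u\<close>.\<close>
  have adj: "v \<in> cspan d T" if v: "v \<in> S" and u: "u \<in> cspan d T" and uv: "braket u v \<noteq> 0" for u v
  proof (rule ccontr)
    assume "v \<notin> cspan d T"
    then have nc: "\<not> connected_set (insert v T)"
      using T(4)[OF v] by blast
    have "braket t v = 0" if "t \<in> T" for t
      using connected_set_insert[of v T d t] nc T(3) that v Sc Tc by blast
    then have "braket v t = 0" if "t \<in> T" for t
      using that braket_eq_0_commute[of t d v] v Sc Tc by auto
    then have "braket v u = 0"
      using braket_cspan_eq_0[OF u Tc] v Sc by auto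
    then show False
      using uv braket_eq_0_commute[of u d v] u cspan_carrier[OF Tc] v Sc by auto
  qed
  obtain t where t: "t \<in> T"
    using T by blast
  have "v \<in> cspan d T" if v: "v \<in> S" for v
  proof -
    have "(t, v) \<in> (transition_edges S)\<^sup>*"
      using S T t v by (auto simp: connected_spanning_set_def connected_set_def)
    then show ?thesis
    proof (induction rule: rtrancl_induct)
      case base
      then show ?case
        using t cspan_superset[OF Tc] by blast
    next
      case (step y z)
      then show ?case
        using adj[of z y] by (auto simp: transition_edges_def)
    qed
  qed
  then have "spans d T"
    using cspan_eq_carrierI[OF sp T(1)] by blast
  then have "connected_basis d T"
    using T st by (auto simp: connected_basis_def is_basis_iff)
  then show thesis
    using that T(1) by blast
qed

lemma connected_basis_imp_spanning: "connected_basis d B \<Longrightarrow> connected_spanning_set d B"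
  by (simp add: connected_basis_def connected_spanning_set_def is_basis_iff)

text \<open>A new state orthogonal to all of \<open>S\<close> would be orthogonal to the whole space
  and hence to itself. So each one is adjacent to some element of \<open>S\<close>, and paths can be
  routed through \<open>S\<close>.\<close>

lemma connected_spanning_superset:
  assumes S: "connected_spanning_set d S" and S': "S \<subseteq> S'" "\<And>v. v \<in> S' \<Longrightarrow> is_state d v"
  shows "connected_spanning_set d S'"
proof -
  have Sc: "S \<subseteq> carrier_vec d" and sp: "cspan d S = carrier_vec d"
    using S by (auto simp: connected_spanning_set_def spans_def)
  have S'c: "v \<in> carrier_vec d" if "v \<in> S'" for v
    using S'(2)[OF that] by (simp add: is_state_def)
  have "transition_edges S \<subseteq> transition_edges S'"
    using S' by (auto simp: transition_edges_def)
  then have SS: "(a, b) \<in> (transition_edges S')\<^sup>*" if "a \<in> S" "b \<in> S" for a b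
    using S that rtrancl_mono[of "transition_edges S" "transition_edges S'"]
    unfolding connected_spanning_set_def connected_set_def by blast
  have near: "\<exists>s\<in>S. (v, s) \<in> transition_edges S' \<and> (s, v) \<in> transition_edges S'" if v: "v \<in> S'" for v
  proof -
    have "\<exists>s\<in>S. braket v s \<noteq> 0"
    proof (rule ccontr)
      assume "\<not> (\<exists>s\<in>S. braket v s \<noteq> 0)"
      then have "braket v v = 0"
        using braket_cspan_eq_0[of v d S v] sp Sc S'c[OF v] by auto
      then show False
        using is_state_braket[OF S'(2)[OF v]] by simp
    qed
    then obtain s where s: "s \<in> S" "braket v s \<noteq> 0"
      by blast
    moreover have "braket s v \<noteq> 0"
      using s braket_eq_0_commute[of v d s] S'c[OF v] Sc by auto
    ultimately show ?thesis
      using v S' by (auto simp: transition_edges_def)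
  qed
  have "(a, b) \<in> (transition_edges S')\<^sup>*" if ab: "a \<in> S'" "b \<in> S'" for a b
  proof -
    obtain s t where "s \<in> S" "t \<in> S" "(a, s) \<in> transition_edges S'" "(t, b) \<in> transition_edges S'"
      using near[OF ab(1)] near[OF ab(2)] by blast
    then show ?thesis
      using SS by (meson converse_rtrancl_into_rtrancl rtrancl_into_rtrancl)
  qed
  moreover have "spans d S'"
    using sp cspan_mono[OF S'(1), of d] cspan_carrier[of S' d] S'c by (auto simp: spans_def)
  ultimately show ?thesis
    using S' by (auto simp: connected_spanning_set_def connected_set_def)
qed

text \<open>Minimality is a matter of counting: a proper subset has fewer than \<open>d\<close>
  elements and cannot span, as an identification set must.\<close>

lemma connected_basis_is_MIS:
  assumes U: "unitary_op (hdim dims) U" and d: "hdim dims \<ge> 2" and B: "connected_basis (hdim dims) B"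
  shows "is_MIS dims U B"
  unfolding is_MIS_def
proof (intro conjI allI impI notI)
  show "is_IS dims U B"
    using connected_spanning_is_IS[OF U _ connected_basis_imp_spanning[OF B]] d by simp
  fix T
  assume T: "T \<subset> B" "is_IS dims U T"
  have "is_basis (hdim dims) B"
    using B by (simp add: connected_basis_def)
  then have fin: "finite B" "card B = hdim dims"
    using is_basis_finite_card by auto
  have "spans (hdim dims) T"
    using IS_imp_connected_spanning[OF U d T(2)] by (simp add: connected_spanning_set_def)
  then have "hdim dims \<le> card T"
    using spans_imp_card_ge finite_subset[of T B] T(1) fin by blast
  then show False
    using psubset_card_mono[OF fin(1) T(1)] fin by simp
qed

subsection \<open>Spectral gap\<close>

lemma eig_mset_eq_proots:
  assumes "A \<in> carrier_mat n n"
  shows "eig_mset A = proots (char_poly A)"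
proof -
  have p: "char_poly A \<noteq> 0"
    using degree_monic_char_poly[OF assms] by auto
  then have fin: "finite {a. poly (char_poly A) a = 0}"
    by (rule poly_roots_finite)
  show ?thesis
  proof (rule multiset_eqI)
    fix x
    have "count (eig_mset A) x = (\<Sum>a\<in>{a. poly (char_poly A) a = 0}. if a = x then Polynomial.order x (char_poly A) else 0)"
      unfolding eig_mset_def count_sum by (intro sum.cong) auto
    also have "\<dots> = Polynomial.order x (char_poly A)"
      using fin p by (auto simp: sum.delta order_root)
    finally show "count (eig_mset A) x = count (proots (char_poly A)) x"
      using p by simp
  qed
qed

lemma eig_mset_factorized:
  assumes "A \<in> carrier_mat n n" "char_poly A = (\<Prod>e\<leftarrow>es. [:- e, 1:])"
  shows "eig_mset A = mset es"
proof -
  have "(\<Sum>e\<leftarrow>es. proots [:- e, 1:]) = mset es"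
    by (induction es) auto
  moreover have "0 \<notin> set (map (\<lambda>e. [:- e, 1:]) es)"
    by (auto simp: image_iff eq_commute[of 0])
  ultimately show ?thesis
    using proots_prod_list[of "map (\<lambda>e. [:- e, 1:]) es"] eig_mset_eq_proots[OF assms(1)] assms(2)
    by (simp add: comp_def)
qed

lemma mtrace_similar_upper_triangular:
  assumes A: "A \<in> carrier_mat n n" and sim: "similar_mat_wit A B P Q"
  shows "mtrace A = sum_list (diag_mat B)"
proof -
  note w = similar_mat_witD2[OF A sim]
  have "mtrace A = mtrace (P * (B * Q))"
    using w by (simp add: assoc_mult_mat[of _ n n _ n _ n])
  also have "\<dots> = mtrace (B * Q * P)"
    using w by (intro mtrace_mult_commute[of _ n n]) auto
  also have "B * Q * P = B"
    using w by (simp add: assoc_mult_mat[of _ n n _ n _ n])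
  also have "mtrace B = sum_list (diag_mat B)"
    using w by (simp add: mtrace_def diag_mat_def sum_list_sum_nth lessThan_atLeast0)
  finally show ?thesis .
qed

text \<open>The Schur decomposition puts the roots of the characteristic polynomial on the diagonal
  of a similar matrix, and similarity preserves the trace.\<close>

lemma eig_mset_sum_length:
  assumes A: "A \<in> carrier_mat n n"
  obtains es where "eig_mset A = mset es" "length es = n" "sum_list es = mtrace A"
    "\<And>e. e \<in> set es \<Longrightarrow> eigenvalue A e"
proof -
  obtain es where es: "char_poly A = (\<Prod>e\<leftarrow>es. [:- e, 1:])" "length es = n"
    using char_poly_factorized[OF A] by blast
  obtain B P Q where "schur_decomposition A es = (B, P, Q)"
    by (cases "schur_decomposition A es") auto
  then have "similar_mat_wit A B P Q" "diag_mat B = es"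
    using schur_decomposition[OF A es(1)] by blast+
  then have "sum_list es = mtrace A"
    using mtrace_similar_upper_triangular[OF A] by simp
  moreover have "eigenvalue A e" if "e \<in> set es" for e
  proof -
    have "poly (char_poly A) e = 0"
      unfolding es(1) using that by (induction es) auto
    then show ?thesis
      using eigenvalue_root_char_poly[OF A] by simp
  qed
  ultimately show thesis
    using that es eig_mset_factorized[OF A es(1)] by blast
qed

text \<open>Pairing an eigenvalue equation with \<open>u\<close> leaves only the eigenvalues 0 and
  1. They add up to the trace 1, so the two largest satisfy a + b \<le> 1 with b \<le> a, which puts
  b at no more than 1/2.\<close>

lemma spectral_gap_ket_bra_pos:
  assumes u: "is_state d u" and d: "d \<ge> 2"
  shows "spectral_gap (ket_bra u u) > 0"
proof -
  let ?P = "ket_bra u u"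
  have uc: "u \<in> carrier_vec d" "braket u u = 1"
    using u by (simp_all add: is_state_def)
  have Pc: "?P \<in> carrier_mat d d"
    using uc by simp
  obtain es where es: "eig_mset ?P = mset es" "length es = d" "sum_list es = mtrace ?P"
    and ev: "\<And>e. e \<in> set es \<Longrightarrow> eigenvalue ?P e"
    using eig_mset_sum_length[OF Pc] by blast
  have eig: "e = 0 \<or> e = 1" if e: "e \<in> set es" for e
  proof -
    obtain v where v: "v \<in> carrier_vec d" "v \<noteq> 0\<^sub>v d" "?P *\<^sub>v v = e \<cdot>\<^sub>v v"
      using ev[OF e] Pc by (auto simp: eigenvalue_def eigenvector_def)
    then have Pv: "braket u v \<cdot>\<^sub>v u = e \<cdot>\<^sub>v v"
      using ket_bra_mult_vec[OF uc(1) uc(1) v(1)] by simp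
    have "braket u (braket u v \<cdot>\<^sub>v u) = braket u (e \<cdot>\<^sub>v v)"
      by (simp only: Pv)
    then have "braket u v * 1 = e * braket u v"
      unfolding braket_smult_right[OF uc(1) uc(1)] braket_smult_right[OF uc(1) v(1)] uc(2) .
    then have "e = 1 \<or> braket u v = 0"
      by (simp only: mult_1_right mult_cancel_right1) blast
    moreover have "e = 0" if "braket u v = 0"
    proof (rule ccontr)
      assume "e \<noteq> 0"
      have "e * v $ i = 0" if "i < d" for i
        using arg_cong[OF Pv, of "\<lambda>w. w $ i"] \<open>braket u v = 0\<close> that uc v by simp
      then have "v = 0\<^sub>v d"
        using \<open>e \<noteq> 0\<close> v(1) by (intro eq_vecI) auto
      then show False
        using v by simp
    qed
    ultimately show ?thesis
      by blast
  qed
  define ys where "ys = rev (sorted_list_of_multiset (image_mset Re (mset es)))"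
  have mys: "mset ys = mset (map Re es)"
    by (simp add: ys_def)
  have len: "length ys = d"
    using mys es(2) by (metis length_map size_mset)
  have "sum_list ys = sum_list (map Re es)"
    using mys by (metis sum_mset_sum_list)
  also have "\<dots> = Re (sum_list es)"
    using Re_sum_list[of "\<lambda>x. x" es] by simp
  also have "\<dots> = 1"
    using es(3) mtrace_ket_bra[OF uc(1) uc(1)] uc(2) by simp
  finally have sum: "sum_list ys = 1" .
  have nonneg: "y \<ge> 0" if "y \<in> set ys" for y
  proof -
    have "y \<in> set (map Re es)"
      using that mys by (metis set_mset_mset)
    then obtain e where "e \<in> set es" "y = Re e"
      by auto
    then show ?thesis
      using eig[of e] by auto
  qed
  \<comment> \<open>The second largest eigenvalue is the entry at index 1 of the descending list;
    \<open>d\<close> being at least 2 makes this entry exist.\<close>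
  have "Suc (Suc 0) \<le> length ys"
    using len d by simp
  then obtain a b zs where ys: "ys = a # b # zs"
    unfolding Suc_le_length_iff by blast
  have "sorted (rev ys)"
    by (simp add: ys_def)
  then have "b \<le> a"
    unfolding ys by (simp add: sorted_append)
  moreover have "sum_list zs \<ge> 0"
    using nonneg unfolding ys by (intro sum_list_nonneg) auto
  ultimately have "b < 1"
    using sum unfolding ys by simp
  then show ?thesis
    using ys unfolding spectral_gap_def second_largest_eigenvalue_def es(1) ys_def by simp
qed

text \<open>A double root 1 fills two places of the sorted list. Eigenvalues with real part above 1
  are not excluded and could only push the second place up, hence the inequality.\<close>

lemma second_largest_ge_1:
  assumes A: "A \<in> carrier_mat d d" and ord: "Polynomial.order 1 (char_poly A) \<ge> 2"
  shows "second_largest_eigenvalue A \<ge> 1"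
proof -
  have p: "char_poly A \<noteq> 0"
    using degree_monic_char_poly[OF A] by auto
  define xs where "xs = sorted_list_of_multiset (image_mset Re (eig_mset A))"
  have "replicate_mset 2 1 \<subseteq># eig_mset A"
    using ord p unfolding eig_mset_eq_proots[OF A] by (simp add: count_le_replicate_mset_subset_eq[symmetric])
  then have "image_mset Re (replicate_mset 2 1) \<subseteq># image_mset Re (eig_mset A)"
    by (rule image_mset_subseteq_mono)
  then have "replicate_mset 2 1 \<subseteq># mset xs"
    by (simp add: xs_def)
  then have c: "2 \<le> count (mset xs) 1"
    by (simp add: count_le_replicate_mset_subset_eq)
  let ?I = "{i. i < length xs \<and> 1 = xs ! i}"
  have card: "2 \<le> card ?I"
    using c unfolding count_mset count_list_eq_length_filter length_filter_conv_card .
  have len: "2 \<le> length xs"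
    using c length_filter_le[of "(=) 1" xs] unfolding count_mset count_list_eq_length_filter by linarith
  have sorted: "sorted xs"
    by (simp add: xs_def)
  have "xs ! (length xs - 2) \<ge> 1"
  proof (rule ccontr)
    assume neg: "\<not> xs ! (length xs - 2) \<ge> 1"
    \<comment> \<open>If the last but one entry were below 1, sortedness would leave only the last
      position for the value 1.\<close>
    have "?I \<subseteq> {length xs - 1}"
    proof
      fix i
      assume i: "i \<in> ?I"
      show "i \<in> {length xs - 1}"
      proof (rule ccontr)
        assume "i \<notin> {length xs - 1}"
        then have "i \<le> length xs - 2"
          using i by auto
        then have "xs ! i \<le> xs ! (length xs - 2)"
          using sorted len by (intro sorted_nth_mono) auto
        then show False
          using i neg by simp
      qed
    qed
    then have "card ?I \<le> card {length xs - 1}"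
      by (intro card_mono) auto
    then show False
      using card by simp
  qed
  then show ?thesis
    using len unfolding second_largest_eigenvalue_def xs_def[symmetric] by (simp add: rev_nth numeral_2_eq_2)
qed

text \<open>Some nonzero combination of two independent fixed vectors vanishes at any given coordinate \<open>i\<close>
  and is thus still fixed after the \<open>i\<close>-th row and column of \<open>A\<close> have been erased.\<close>

lemma order_char_poly_ge_2:
  fixes A :: "complex mat"
  assumes A: "A \<in> carrier_mat d d" and u: "u \<in> carrier_vec d" "A *\<^sub>v u = u"
    and w: "w \<in> carrier_vec d" "A *\<^sub>v w = w" and w0: "w \<noteq> 0\<^sub>v d"
    and indep: "\<And>c. u \<noteq> c \<cdot>\<^sub>v w"
  shows "Polynomial.order 1 (char_poly A) \<ge> 2"
proof -
  have p: "char_poly A \<noteq> 0"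
    using degree_monic_char_poly[OF A] by auto
  have root: "poly (char_poly B) 1 = 0" if "B \<in> carrier_mat d d" "v \<in> carrier_vec d" "v \<noteq> 0\<^sub>v d" "B *\<^sub>v v = v"
    for B :: "complex mat" and v
    using that eigenvalue_root_char_poly[of B d 1] by (auto simp: eigenvalue_def eigenvector_def)
  have er: "poly (char_poly (mat_erase A i i)) 1 = 0" if i: "i < d" for i
  proof -
    obtain v where v: "v \<in> carrier_vec d" "v \<noteq> 0\<^sub>v d" "A *\<^sub>v v = v" "v $ i = 0"
    proof (cases "w $ i = 0")
      case True
      then show thesis
        using that[of w] w w0 by simp
    next
      case False
      define c where "c = u $ i / w $ i"
      define v where "v = u - c \<cdot>\<^sub>v w"
      have "A *\<^sub>v v = v"
        using A u w unfolding v_def by (simp add: mult_minus_distrib_mat_vec[of _ d d] mult_mat_vec[of _ d d])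
      moreover have "v \<noteq> 0\<^sub>v d"
      proof
        assume v0: "v = 0\<^sub>v d"
        have "c \<cdot>\<^sub>v w + v = u"
          unfolding v_def using u w by (intro add_diff_cancel_vec[of _ d]) auto
        then show False
          using indep[of c] v0 w by simp
      qed
      ultimately show thesis
        using that[of v] u w i False by (simp add: v_def c_def)
    qed
    have "mat_erase A i i *\<^sub>v v = v"
    proof (rule eq_vecI)
      fix k
      assume "k < dim_vec v"
      then have k: "k < d"
        using v by simp
      have "(mat_erase A i i *\<^sub>v v) $ k = (\<Sum>l<d. mat_erase A i i $$ (k, l) * v $ l)"
        using A v k by (intro mult_mat_vec_index_sum[of _ d d]) auto
      also have "\<dots> = (\<Sum>l<d. if k = i then 0 else A $$ (k, l) * v $ l)"
        using A v(4) k by (intro sum.cong) (auto simp: mat_erase_def)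
      also have "\<dots> = (if k = i then 0 else (A *\<^sub>v v) $ k)"
        using mult_mat_vec_index_sum[OF A v(1) k] by simp
      also have "\<dots> = v $ k"
        using v by simp
      finally show "(mat_erase A i i *\<^sub>v v) $ k = v $ k" .
    qed (use A v in \<open>simp add: mat_erase_def\<close>)
    then show ?thesis
      using root[of "mat_erase A i i" v] A v by simp
  qed
  \<comment> \<open>\<open>mat_erase\<close> keeps the dimension and fills a row and a column with
    zeros. The sum of the characteristic polynomials of the erased matrices is therefore X times the
    derivative, which explains the factor \<open>monom 1 1\<close>. Every summand vanishes at
    1.\<close>
  have "poly (monom 1 1 * pderiv (char_poly A)) 1 = 0"
    unfolding pderiv_char_poly_mat_erase[OF A] poly_sum by (simp add: er)
  then have d0: "poly (pderiv (char_poly A)) 1 = 0"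
    by (simp add: poly_monom)
  have r: "poly (char_poly A) 1 = 0"
    using root[OF A w(1) w0 w(2)] .
  \<comment> \<open>The order of a root is only meaningful for a nonzero polynomial. A zero
    derivative would make the characteristic polynomial a nonzero constant, although it has the root
    1.\<close>
  have "pderiv (char_poly A) \<noteq> 0"
  proof
    assume "pderiv (char_poly A) = 0"
    then have "degree (char_poly A) = 0"
      by (simp add: pderiv_eq_0_iff)
    then show False
      using r p by (metis degree_eq_zeroE poly_pCons mult_zero_right poly_0 add.right_neutral pCons_0_0)
  qed
  then have "Polynomial.order 1 (pderiv (char_poly A)) \<noteq> 0"
    using d0 order_root by blast
  then show ?thesis
    using order_pderiv[OF p r] by simp
qed

lemma spectral_gap_pos_imp_unique_fixed:
  assumes "A \<in> carrier_mat d d" "spectral_gap A > 0"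
    and "u \<in> carrier_vec d" "A *\<^sub>v u = u" "w \<in> carrier_vec d" "A *\<^sub>v w = w" "w \<noteq> 0\<^sub>v d"
  obtains c where "u = c \<cdot>\<^sub>v w"
  using order_char_poly_ge_2[OF assms(1,3,4,5,6,7)] second_largest_ge_1[OF assms(1)] assms(2)
  by (force simp: spectral_gap_def)

subsection \<open>Kronecker products\<close>

text \<open>The reindexing behind the Kronecker computations: a pair of indices is the block number
  and the position within a block of length \<open>n\<close>.\<close>

lemma sum_div_mod:
  fixes f :: "nat \<Rightarrow> nat \<Rightarrow> 'a::comm_monoid_add"
  shows "(\<Sum>k<m * n. f (k div n) (k mod n)) = (\<Sum>i<m. \<Sum>j<n. f i j)"
proof -
  have "(\<Sum>j<n. f i j) = (\<Sum>k = i * n..<i * n + n. f (k div n) (k mod n))" for i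
    by (rule sum.reindex_bij_witness[of _ "\<lambda>k. k - i * n" "\<lambda>j. i * n + j"]) auto
  then show ?thesis
    by (simp add: sum.nat_group[symmetric])
qed

lemma div_mod_less:
  fixes k m n :: nat
  assumes "k < m * n"
  shows "k div n < m" "k mod n < n"
proof -
  have "n > 0"
    using assms by (cases n) auto
  then show "k div n < m" "k mod n < n"
    using assms by (simp_all add: less_mult_imp_div_less)
qed

lemma kron_vec_carrier: "a \<in> carrier_vec m \<Longrightarrow> b \<in> carrier_vec n \<Longrightarrow> kron_vec a b \<in> carrier_vec (m * n)"
  by (auto simp: kron_vec_def)

lemma index_kron_vec:
  assumes "a \<in> carrier_vec m" "b \<in> carrier_vec n" "k < m * n"
  shows "kron_vec a b $ k = a $ (k div n) * b $ (k mod n)"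
  using assms by (auto simp: kron_vec_def)

lemma kron_mat_carrier:
  "A \<in> carrier_mat m m \<Longrightarrow> B \<in> carrier_mat n n \<Longrightarrow> kron_mat A B \<in> carrier_mat (m * n) (m * n)"
  by (auto simp: kron_mat_def)

lemma index_kron_mat:
  assumes "A \<in> carrier_mat m m" "B \<in> carrier_mat n n" "i < m * n" "j < m * n"
  shows "kron_mat A B $$ (i, j) = A $$ (i div n, j div n) * B $$ (i mod n, j mod n)"
  using assms by (auto simp: kron_mat_def)

lemma braket_kron_vec:
  assumes "a \<in> carrier_vec m" "b \<in> carrier_vec n" "a' \<in> carrier_vec m" "b' \<in> carrier_vec n"
  shows "braket (kron_vec a b) (kron_vec a' b') = braket a a' * braket b b'"
proof -
  have "braket (kron_vec a b) (kron_vec a' b')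
      = (\<Sum>k<m * n. (cnj (a $ (k div n)) * a' $ (k div n)) * (cnj (b $ (k mod n)) * b' $ (k mod n)))"
    using assms by (subst braket_eq_sum[of _ "m * n"]) (auto simp: kron_vec_carrier index_kron_vec[of _ m _ n] intro!: sum.cong)
  also have "\<dots> = (\<Sum>i<m. \<Sum>j<n. (cnj (a $ i) * a' $ i) * (cnj (b $ j) * b' $ j))"
    by (rule sum_div_mod)
  also have "\<dots> = braket a a' * braket b b'"
    using assms by (simp add: braket_eq_sum[of _ m] braket_eq_sum[of _ n] sum_product)
  finally show ?thesis .
qed

lemma kron_mat_mult_kron_vec:
  assumes A: "A \<in> carrier_mat m m" and B: "B \<in> carrier_mat n n"
    and a: "a \<in> carrier_vec m" and b: "b \<in> carrier_vec n"
  shows "kron_mat A B *\<^sub>v kron_vec a b = kron_vec (A *\<^sub>v a) (B *\<^sub>v b)"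
proof (rule eq_vecI)
  have c: "A *\<^sub>v a \<in> carrier_vec m" "B *\<^sub>v b \<in> carrier_vec n"
    using assms by auto
  fix i
  assume "i < dim_vec (kron_vec (A *\<^sub>v a) (B *\<^sub>v b))"
  then have i: "i < m * n"
    using kron_vec_carrier[OF c] by simp
  note i' = div_mod_less[OF i]
  have "(kron_mat A B *\<^sub>v kron_vec a b) $ i = (\<Sum>k<m * n. kron_mat A B $$ (i, k) * kron_vec a b $ k)"
    using i by (intro mult_mat_vec_index_sum[of _ "m * n" "m * n"] kron_mat_carrier kron_vec_carrier assms)
  also have "\<dots> = (\<Sum>k<m * n. (A $$ (i div n, k div n) * a $ (k div n)) * (B $$ (i mod n, k mod n) * b $ (k mod n)))"
    using i by (intro sum.cong refl) (simp add: index_kron_mat[OF A B] index_kron_vec[OF a b])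
  also have "\<dots> = (\<Sum>k<m. \<Sum>l<n. (A $$ (i div n, k) * a $ k) * (B $$ (i mod n, l) * b $ l))"
    by (rule sum_div_mod)
  also have "\<dots> = (A *\<^sub>v a) $ (i div n) * (B *\<^sub>v b) $ (i mod n)"
    unfolding mult_mat_vec_index_sum[OF A a i'(1)] mult_mat_vec_index_sum[OF B b i'(2)] by (simp add: sum_product)
  also have "\<dots> = kron_vec (A *\<^sub>v a) (B *\<^sub>v b) $ i"
    using index_kron_vec[OF c i] by simp
  finally show "(kron_mat A B *\<^sub>v kron_vec a b) $ i = kron_vec (A *\<^sub>v a) (B *\<^sub>v b) $ i" .
qed (use assms in \<open>simp add: kron_mat_def kron_vec_def\<close>)

lemma ket_bra_kron_vec: "ket_bra (kron_vec a b) (kron_vec a b) = kron_mat (ket_bra a a) (ket_bra b b)"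
proof (rule eq_matI)
  fix i j
  assume "i < dim_row (kron_mat (ket_bra a a) (ket_bra b b))" "j < dim_col (kron_mat (ket_bra a a) (ket_bra b b))"
  then have ij: "i < dim_vec a * dim_vec b" "j < dim_vec a * dim_vec b"
    by (simp_all add: kron_mat_def)
  then show "ket_bra (kron_vec a b) (kron_vec a b) $$ (i, j) = kron_mat (ket_bra a a) (ket_bra b b) $$ (i, j)"
    using div_mod_less[OF ij(1)] div_mod_less[OF ij(2)] by (simp add: kron_mat_def kron_vec_def ket_bra_def)
qed (simp_all add: kron_mat_def kron_vec_def)

lemma ket_bra_kron_vec_list:
  "ket_bra (kron_vec_list vs) (kron_vec_list vs) = kron_mat_list (map (\<lambda>v. ket_bra v v) vs)"
proof (induction vs)
  case Nil
  then show ?case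
    by (intro eq_matI) (auto simp: ket_bra_def)
next
  case (Cons v vs)
  then show ?case
    by (simp add: ket_bra_kron_vec)
qed

lemma kron_vec_list_carrier:
  assumes "list_all2 (\<lambda>m v. v \<in> carrier_vec m) dims vs"
  shows "kron_vec_list vs \<in> carrier_vec (prod_list dims)"
  using assms by (induction rule: list_all2_induct) (auto intro: kron_vec_carrier)

lemma kron_vec_list_state:
  assumes "list_all2 is_state dims vs"
  shows "is_state (prod_list dims) (kron_vec_list vs)"
  using assms
proof (induction rule: list_all2_induct)
  case Nil
  then show ?case
    by (simp add: is_state_def braket_eq_sum[of _ 1])
next
  case (Cons m ms v vs)
  then show ?case
    using braket_kron_vec[of v m "kron_vec_list vs" "prod_list ms" v "kron_vec_list vs"]
    by (simp add: is_state_def kron_vec_carrier)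
qed

lemma kron_mat_list_carrier:
  assumes "list_all2 (\<lambda>m A. A \<in> carrier_mat m m) dims As"
  shows "kron_mat_list As \<in> carrier_mat (prod_list dims) (prod_list dims)"
  using assms by (induction rule: list_all2_induct) (auto intro: kron_mat_carrier)

lemma kron_mat_list_mult_kron_vec_list:
  assumes "list_all2 (\<lambda>m A. A \<in> carrier_mat m m) dims As" "list_all2 (\<lambda>m v. v \<in> carrier_vec m) dims vs"
  shows "kron_mat_list As *\<^sub>v kron_vec_list vs = kron_vec_list (map2 (*\<^sub>v) As vs)"
  using assms
proof (induction arbitrary: vs rule: list_all2_induct)
  case Nil
  then show ?case
    by simp
next
  case (Cons m ms A As)
  then obtain v vs' where vs: "vs = v # vs'" "v \<in> carrier_vec m" "list_all2 (\<lambda>m v. v \<in> carrier_vec m) ms vs'"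
    by (auto simp: list_all2_Cons1)
  then show ?case
    using Cons kron_mat_mult_kron_vec[OF Cons.hyps(1) kron_mat_list_carrier[OF Cons.hyps(2)] vs(2) kron_vec_list_carrier[OF vs(3)]]
    by simp
qed

text \<open>Makes distinct outcomes exclusive: if a single party annihilates its factor, the whole
  product state is annihilated.\<close>

lemma kron_vec_list_zero:
  assumes "list_all2 (\<lambda>m v. v \<in> carrier_vec m) dims vs" "i < length dims" "vs ! i = 0\<^sub>v (dims ! i)"
  shows "kron_vec_list vs = 0\<^sub>v (prod_list dims)"
  using assms
proof (induction arbitrary: i rule: list_all2_induct)
  case Nil
  then show ?case
    by simp
next
  case (Cons m ms v vs)
  note c = Cons.hyps(1) kron_vec_list_carrier[OF Cons.hyps(2)]
  have "v = 0\<^sub>v m \<or> kron_vec_list vs = 0\<^sub>v (prod_list ms)"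
    using Cons by (cases i) auto
  then have "kron_vec v (kron_vec_list vs) $ k = 0" if "k < m * prod_list ms" for k
    using index_kron_vec[OF c that] div_mod_less[OF that] by auto
  then show ?case
    using kron_vec_carrier[OF c] by (intro eq_vecI) auto
qed

text \<open>Used contrapositively: an outcome with nonzero projector has nonzero projectors at all
  parties.\<close>

lemma kron_mat_list_zero:
  assumes "list_all2 (\<lambda>m A. A \<in> carrier_mat m m) dims As" "i < length dims" "As ! i = 0\<^sub>m (dims ! i) (dims ! i)"
  shows "kron_mat_list As = 0\<^sub>m (prod_list dims) (prod_list dims)"
  using assms
proof (induction arbitrary: i rule: list_all2_induct)
  case Nil
  then show ?case
    by simp
next
  case (Cons m ms A As)
  note c = Cons.hyps(1) kron_mat_list_carrier[OF Cons.hyps(2)]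
  have "A = 0\<^sub>m m m \<or> kron_mat_list As = 0\<^sub>m (prod_list ms) (prod_list ms)"
    using Cons by (cases i) auto
  then have "kron_mat A (kron_mat_list As) $$ (k, l) = 0" if "k < m * prod_list ms" "l < m * prod_list ms" for k l
    using index_kron_mat[OF c that] div_mod_less[OF that(1)] div_mod_less[OF that(2)] by auto
  then show ?case
    using kron_mat_carrier[OF c] by (intro eq_matI) auto
qed

section \<open>Product states\<close>

lemma Prod_iff: "\<psi> \<in> Prod dims \<longleftrightarrow> (\<exists>vs. \<psi> = kron_vec_list vs \<and> list_all2 is_state dims vs)"
  by (auto simp: Prod_def list_all2_conv_all_nth)

lemma Prod_is_state: "\<psi> \<in> Prod dims \<Longrightarrow> is_state (hdim dims) \<psi>"
  by (auto simp: Prod_iff hdim_def kron_vec_list_state)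

lemma ProdU_is_state: "\<psi> \<in> ProdU dims U \<Longrightarrow> is_state (hdim dims) \<psi>"
  by (auto simp: ProdU_def Prod_is_state)

text \<open>The phase is absorbed into the first tensor factor, which exists because
  \<open>dims\<close> is nonempty.\<close>

lemma Prod_smult:
  assumes "\<psi> \<in> Prod dims" "dims \<noteq> []" "cnj c * c = 1"
  shows "c \<cdot>\<^sub>v \<psi> \<in> Prod dims"
proof -
  obtain vs where vs: "\<psi> = kron_vec_list vs" "list_all2 is_state dims vs"
    using assms by (auto simp: Prod_iff)
  then obtain m ms v vs' where *: "dims = m # ms" "vs = v # vs'" "is_state m v" "list_all2 is_state ms vs'"
    using assms(2) by (cases dims; cases vs) auto
  have v: "v \<in> carrier_vec m" "braket v v = 1"
    using *(3) by (simp_all add: is_state_def)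
  have "braket (c \<cdot>\<^sub>v v) (c \<cdot>\<^sub>v v) = cnj c * c"
    using v by (simp add: braket_smult_left[of _ m] braket_smult_right[of _ m])
  then have "is_state m (c \<cdot>\<^sub>v v)"
    unfolding is_state_def using v assms(3) by simp
  moreover have "c \<cdot>\<^sub>v kron_vec v (kron_vec_list vs') = kron_vec (c \<cdot>\<^sub>v v) (kron_vec_list vs')"
    using div_mod_less by (intro eq_vecI) (auto simp: kron_vec_def)
  ultimately show ?thesis
    using vs * by (auto simp: Prod_iff intro!: exI[of _ "(c \<cdot>\<^sub>v v) # vs'"])
qed

subsection \<open>Verification protocols\<close>

lemma projector_ket_bra:
  assumes "is_state d u"
  shows "projector d (ket_bra u u)"
proof -
  have u: "u \<in> carrier_vec d" "braket u u = 1"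
    using assms by (simp_all add: is_state_def)
  have "ket_bra u u * ket_bra u u = ket_bra (ket_bra u u *\<^sub>v u) u"
    by (rule mult_ket_bra[OF ket_bra_carrier[OF u(1) u(1)] u(1) u(1)])
  also have "ket_bra u u *\<^sub>v u = u"
    using ket_bra_mult_vec[OF u(1) u(1) u(1)] u(2) by simp
  finally show ?thesis
    using u(1) by (simp add: projector_def)
qed

lemma projector_complement:
  assumes "projector d P"
  shows "projector d (1\<^sub>m d - P)"
proof -
  have P: "P \<in> carrier_mat d d" "P * P = P" "dag P = P"
    using assms by (auto simp: projector_def)
  have Q: "1\<^sub>m d - P \<in> carrier_mat d d"
    using P by (simp add: minus_carrier_mat)
  have minus_zero: "X - 0\<^sub>m d d = X" if "X \<in> carrier_mat d d" for X :: "complex mat"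
    using that by (intro eq_matI) auto
  have "(1\<^sub>m d - P) * (1\<^sub>m d - P) = (1\<^sub>m d - P) - P * (1\<^sub>m d - P)"
    using minus_mult_distrib_mat[of "1\<^sub>m d" d d P "1\<^sub>m d - P" d] P Q by simp
  also have "P * (1\<^sub>m d - P) = P * 1\<^sub>m d - P * P"
    using P by (intro mult_minus_distrib_mat[of _ d d _ d]) auto
  also have "P * 1\<^sub>m d - P * P = 0\<^sub>m d d"
    using P by (intro eq_matI) auto
  also have "(1\<^sub>m d - P) - 0\<^sub>m d d = 1\<^sub>m d - P"
    by (rule minus_zero[OF Q])
  finally have "(1\<^sub>m d - P) * (1\<^sub>m d - P) = 1\<^sub>m d - P" .
  then show ?thesis
    using P Q dag_diff[of "1\<^sub>m d" d d P] by (simp add: projector_def)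
qed

lemma projector_braket:
  assumes "projector d P" "v \<in> carrier_vec d"
  shows "braket v (P *\<^sub>v v) = braket (P *\<^sub>v v) (P *\<^sub>v v)"
  using braket_mult_mat_vec[of P d d v "P *\<^sub>v v"] projector_mult_mult_vec[OF assms]
    projector_mult_vec_carrier[OF assms] assms by (simp add: projector_def)

text \<open>\<open>projective_measurement\<close> demands only that the projectors sum to the
  identity. Orthogonality follows because the weights of the outcomes at \<open>w\<close> are
  nonnegative and add up to \<open>braket w w\<close>, all of which is already taken by outcome
  \<open>i\<close>.\<close>

lemma projective_measurement_orthogonal:
  assumes Ps: "projective_measurement m Ps" and ij: "i < length Ps" "j < length Ps" "i \<noteq> j"
    and w: "w \<in> carrier_vec m" "Ps ! i *\<^sub>v w = w"
  shows "Ps ! j *\<^sub>v w = 0\<^sub>v m"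
proof -
  have P: "projector m (Ps ! l)" if "l < length Ps" for l
    using Ps that by (auto simp: projective_measurement_def projector_def)
  define f where "f l = Re (braket w (Ps ! l *\<^sub>v w))" for l
  have f: "f l \<ge> 0" if "l < length Ps" for l
    using braket_self_real(2)[OF projector_mult_vec_carrier[OF P[OF that] w(1)]] projector_braket[OF P[OF that] w(1)]
    by (simp add: f_def)
  have "braket w w = braket w (msum m Ps *\<^sub>v w)"
    using Ps w by (simp add: projective_measurement_def)
  also have "\<dots> = (\<Sum>P\<leftarrow>Ps. braket w (P *\<^sub>v w))"
    using Ps w by (intro braket_msum_mult_vec) (auto simp: projective_measurement_def)
  finally have "Re (braket w w) = (\<Sum>P\<leftarrow>Ps. Re (braket w (P *\<^sub>v w)))"
    by (simp add: Re_sum_list)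
  \<comment> \<open>Outcomes are positions in the list, at which the same matrix may occur more than
    once, so the sum runs over indices.\<close>
  also have "\<dots> = (\<Sum>l<length Ps. f l)"
    by (simp add: sum_list_sum_nth f_def lessThan_atLeast0)
  also have "\<dots> = f i + (\<Sum>l\<in>{..<length Ps} - {i}. f l)"
    using ij by (intro sum.remove) auto
  finally have "(\<Sum>l\<in>{..<length Ps} - {i}. f l) = 0"
    using w by (simp add: f_def)
  then have "f j = 0"
    using ij f by (subst (asm) sum_nonneg_eq_0_iff) auto
  then have "braket (Ps ! j *\<^sub>v w) (Ps ! j *\<^sub>v w) = 0"
    using projector_braket[OF P[OF ij(2)] w(1)] braket_self_real(1)[OF projector_mult_vec_carrier[OF P[OF ij(2)] w(1)]]
    by (simp add: f_def complex_eq_iff)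
  then show ?thesis
    using braket_self_eq_0[OF projector_mult_vec_carrier[OF P[OF ij(2)] w(1)]] by simp
qed

text \<open>Separates the list of local projectors from their Kronecker product, so that facts about
  products of lists apply to outcomes.\<close>

definition outcome_factors :: "complex mat list list \<Rightarrow> nat list \<Rightarrow> complex mat list" where
  "outcome_factors Ms as = map (\<lambda>i. Ms ! i ! (as ! i)) [0..<length Ms]"

lemma outcome_proj_factors: "outcome_proj Ms as = kron_mat_list (outcome_factors Ms as)"
  by (simp add: outcome_proj_def outcome_factors_def)

lemma nth_outcome_factors: "i < length Ms \<Longrightarrow> outcome_factors Ms as ! i = Ms ! i ! (as ! i)"
  by (simp add: outcome_factors_def)

lemma length_outcome_factors: "length (outcome_factors Ms as) = length Ms"
  by (simp add: outcome_factors_def)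

lemma outcome_factor_projector:
  assumes "local_measurement dims Ms" "outcome Ms as" "i < length dims"
  shows "projector (dims ! i) (outcome_factors Ms as ! i)"
proof -
  have i: "i < length Ms" "as ! i < length (Ms ! i)" "projective_measurement (dims ! i) (Ms ! i)"
    using assms by (auto simp: local_measurement_def outcome_def)
  then have "Ms ! i ! (as ! i) \<in> set (Ms ! i)"
    by simp
  then show ?thesis
    using i by (simp add: nth_outcome_factors projector_def projective_measurement_def)
qed

lemma outcome_factors_carrier:
  assumes "local_measurement dims Ms" "outcome Ms as"
  shows "list_all2 (\<lambda>m A. A \<in> carrier_mat m m) dims (outcome_factors Ms as)"
  unfolding list_all2_conv_all_nth
  using outcome_factor_projector[OF assms] assms(1)
  by (auto simp: local_measurement_def length_outcome_factors projector_def)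

lemma outcome_proj_carrier:
  assumes "local_measurement dims Ms" "outcome Ms as"
  shows "outcome_proj Ms as \<in> carrier_mat (hdim dims) (hdim dims)"
  using kron_mat_list_carrier[OF outcome_factors_carrier[OF assms]]
  by (simp add: outcome_proj_factors hdim_def)

lemma test_proj_carrier:
  assumes "valid_test dims t"
  shows "test_proj dims t \<in> carrier_mat (hdim dims) (hdim dims)"
  unfolding test_proj_def
  using assms by (intro msum_map_carrier outcome_proj_carrier) (auto simp: valid_test_def)

lemma outcome_proj_mult_kron_vec_list:
  assumes "local_measurement dims Ms" "outcome Ms as" "list_all2 (\<lambda>m v. v \<in> carrier_vec m) dims ws"
  shows "outcome_proj Ms as *\<^sub>v kron_vec_list ws = kron_vec_list (map2 (*\<^sub>v) (outcome_factors Ms as) ws)"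
  using kron_mat_list_mult_kron_vec_list[OF outcome_factors_carrier[OF assms(1,2)] assms(3)]
  by (simp add: outcome_proj_factors)

text \<open>An accepted outcome with nonzero projector has a product state in its range, and by orthogonality
  of distinct outcomes this state passes the whole test.\<close>

lemma test_fixes_product_state:
  assumes t: "valid_test dims t" and nz: "test_proj dims t \<noteq> 0\<^sub>m (hdim dims) (hdim dims)"
  obtains w where "w \<in> Prod dims" "test_proj dims t *\<^sub>v w = w"
proof -
  obtain Ms accs where tt: "t = (Ms, accs)"
    by (cases t)
  have lm: "local_measurement dims Ms" and dist: "distinct accs" and out: "\<And>as. as \<in> set accs \<Longrightarrow> outcome Ms as"
    using t by (auto simp: tt valid_test_def)
  have len: "length Ms = length dims"
    using lm by (simp add: local_measurement_def)
  let ?d = "hdim dims"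
  have Ec: "outcome_proj Ms as \<in> carrier_mat ?d ?d" if "as \<in> set accs" for as
    using outcome_proj_carrier[OF lm out[OF that]] .
  have T: "test_proj dims t = msum ?d (map (outcome_proj Ms) accs)"
    by (simp add: test_proj_def tt)
  have "\<exists>as\<in>set accs. outcome_proj Ms as \<noteq> 0\<^sub>m ?d ?d"
  proof (rule ccontr)
    assume "\<not> ?thesis"
    then have "msum ?d (map (outcome_proj Ms) accs) = msum ?d (map (\<lambda>_. 0\<^sub>m ?d ?d) accs)"
      by (simp cong: map_cong)
    also have "\<dots> = 0\<^sub>m ?d ?d"
      by (induction accs) auto
    finally show False
      using nz T by simp
  qed
  then obtain as where as: "as \<in> set accs" "outcome_proj Ms as \<noteq> 0\<^sub>m ?d ?d"
    by blast
  \<comment> \<open>The local projectors of the chosen outcome are nonzero, so a vector in the range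
    of each can be normalized to a fixed local state.\<close>
  have "\<exists>w. is_state (dims ! i) w \<and> outcome_factors Ms as ! i *\<^sub>v w = w" if i: "i < length dims" for i
  proof -
    let ?P = "outcome_factors Ms as ! i" and ?m = "dims ! i"
    have P: "projector ?m ?P"
      using outcome_factor_projector[OF lm out[OF as(1)] i] .
    have "?P \<noteq> 0\<^sub>m ?m ?m"
      using kron_mat_list_zero[OF outcome_factors_carrier[OF lm out[OF as(1)]] i] as(2)
      by (auto simp: outcome_proj_factors hdim_def)
    then obtain v where v: "v \<in> carrier_vec ?m" "?P *\<^sub>v v \<noteq> 0\<^sub>m ?m ?m *\<^sub>v v"
      using eq_mat_on_vecs[of ?P ?m ?m "0\<^sub>m ?m ?m"] P by (auto simp: projector_def)
    have "0\<^sub>m ?m ?m *\<^sub>v v = 0\<^sub>v ?m"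
      using v(1) by (intro eq_vecI) auto
    then have "?P *\<^sub>v v \<noteq> 0\<^sub>v ?m"
      using v(2) by simp
    then obtain c where c: "is_state ?m (c \<cdot>\<^sub>v (?P *\<^sub>v v))"
      using normalize_to_state[OF projector_mult_vec_carrier[OF P v(1)]] by blast
    have "?P *\<^sub>v (c \<cdot>\<^sub>v (?P *\<^sub>v v)) = c \<cdot>\<^sub>v (?P *\<^sub>v v)"
      using mult_mat_vec[of ?P ?m ?m "?P *\<^sub>v v" c] projector_mult_vec_carrier[OF P v(1)]
        projector_mult_mult_vec[OF P v(1)] P by (simp add: projector_def)
    then show ?thesis
      using c by blast
  qed
  then obtain g where g: "\<And>i. i < length dims \<Longrightarrow> is_state (dims ! i) (g i) \<and> outcome_factors Ms as ! i *\<^sub>v g i = g i"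
    by metis
  define ws where "ws = map g [0..<length dims]"
  have ws: "list_all2 is_state dims ws"
    using g by (simp add: list_all2_conv_all_nth ws_def)
  then have wsc: "list_all2 (\<lambda>m v. v \<in> carrier_vec m) dims ws"
    by (rule list_all2_mono) (simp add: is_state_def)
  define w where "w = kron_vec_list ws"
  have w: "w \<in> Prod dims"
    using ws by (auto simp: Prod_iff w_def)
  then have wc: "w \<in> carrier_vec ?d"
    using Prod_is_state is_state_carrier by blast
  have own: "outcome_proj Ms as *\<^sub>v w = w"
  proof -
    have "map2 (*\<^sub>v) (outcome_factors Ms as) ws = ws"
      using g by (intro nth_equalityI) (auto simp: ws_def length_outcome_factors len)
    then show ?thesis
      using outcome_proj_mult_kron_vec_list[OF lm out[OF as(1)] wsc] by (simp add: w_def)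
  qed
  \<comment> \<open>A different outcome differs at some party \<open>i\<close>, where its local
    projector annihilates \<open>g i\<close>; one zero factor suffices.\<close>
  have other: "outcome_proj Ms bs *\<^sub>v w = 0\<^sub>v ?d" if bs: "bs \<in> set accs" "bs \<noteq> as" for bs
  proof -
    have "length bs = length dims" "length as = length dims"
      using out[OF bs(1)] out[OF as(1)] len by (auto simp: outcome_def)
    then obtain i where i: "i < length dims" "bs ! i \<noteq> as ! i"
      using bs(2) by (metis nth_equalityI)
    have "outcome_factors Ms bs ! i *\<^sub>v g i = 0\<^sub>v (dims ! i)"
      using g[OF i(1)] i len out[OF bs(1)] out[OF as(1)] lm is_state_carrier[of "dims ! i" "g i"]
        projective_measurement_orthogonal[of "dims ! i" "Ms ! i" "as ! i" "bs ! i" "g i"]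
      by (simp add: outcome_def local_measurement_def nth_outcome_factors)
    moreover have "list_all2 (\<lambda>m v. v \<in> carrier_vec m) dims (map2 (*\<^sub>v) (outcome_factors Ms bs) ws)"
      using projector_mult_vec_carrier[OF outcome_factor_projector[OF lm out[OF bs(1)]]] wsc len
      by (auto simp: list_all2_conv_all_nth length_outcome_factors)
    ultimately have "kron_vec_list (map2 (*\<^sub>v) (outcome_factors Ms bs) ws) = 0\<^sub>v (prod_list dims)"
      using i len by (intro kron_vec_list_zero[of _ _ i]) (auto simp: ws_def length_outcome_factors)
    then show ?thesis
      using outcome_proj_mult_kron_vec_list[OF lm out[OF bs(1)] wsc] by (simp add: w_def hdim_def)
  qed
  have Tc: "test_proj dims t \<in> carrier_mat ?d ?d"
    using test_proj_carrier[OF t] .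
  \<comment> \<open>Distinctness of the accepted outcomes enters here: the outcome \<open>as\<close>
    occurs once, so \<open>w\<close> is reproduced with factor 1.\<close>
  have Tw: "braket u (test_proj dims t *\<^sub>v w) = braket u w" if u: "u \<in> carrier_vec ?d" for u
  proof -
    have "braket u (test_proj dims t *\<^sub>v w) = (\<Sum>bs\<leftarrow>accs. braket u (outcome_proj Ms bs *\<^sub>v w))"
      unfolding T using Ec u wc by (rule braket_msum_map)
    also have "\<dots> = (\<Sum>bs\<in>set accs. braket u (outcome_proj Ms bs *\<^sub>v w))"
      using dist by (rule sum_list_distinct_conv_sum_set)
    also have "\<dots> = (\<Sum>bs\<in>set accs. if bs = as then braket u w else 0)"
      using own other u by (intro sum.cong) auto
    also have "\<dots> = braket u w"
      using as(1) by simp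
    finally show ?thesis .
  qed
  have Twc: "test_proj dims t *\<^sub>v w \<in> carrier_vec ?d"
    using Tc wc by simp
  define y where "y = test_proj dims t *\<^sub>v w - w"
  have yc: "y \<in> carrier_vec ?d"
    using Twc wc by (simp add: y_def)
  have "braket y y = braket y (test_proj dims t *\<^sub>v w) - braket y w"
    using braket_diff_right[OF yc Twc wc] by (simp add: y_def)
  then have "y = 0\<^sub>v ?d"
    using Tw[OF yc] braket_self_eq_0[OF yc] by simp
  then have "test_proj dims t *\<^sub>v w = w"
    using add_diff_cancel_vec[OF wc Twc] wc by (simp add: y_def)
  then show thesis
    using that w by blast
qed

text \<open>The test fixes the target and also some product state. A positive gap makes the two
  proportional, and normalization reduces the factor to a phase.\<close>

lemma single_test_product:
  assumes t: "valid_test dims t" and \<phi>: "is_state (hdim dims) \<phi>" "test_proj dims t *\<^sub>v \<phi> = \<phi>"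
    and gap: "spectral_gap (test_proj dims t) > 0" and dims: "dims \<noteq> []"
  shows "\<phi> \<in> Prod dims"
proof -
  let ?d = "hdim dims"
  have \<phi>c: "\<phi> \<in> carrier_vec ?d" "braket \<phi> \<phi> = 1"
    using \<phi> by (simp_all add: is_state_def)
  have "test_proj dims t \<noteq> 0\<^sub>m ?d ?d"
  proof
    assume 0: "test_proj dims t = 0\<^sub>m ?d ?d"
    have "0\<^sub>m ?d ?d *\<^sub>v \<phi> = 0\<^sub>v ?d"
      using \<phi>c by (intro eq_vecI) auto
    then show False
      using 0 \<phi>(2) is_state_nonzero[OF \<phi>(1)] by simp
  qed
  then obtain w where w: "w \<in> Prod dims" "test_proj dims t *\<^sub>v w = w"
    using test_fixes_product_state[OF t] by blast
  have ws: "is_state ?d w"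
    using Prod_is_state[OF w(1)] .
  then have wc: "w \<in> carrier_vec ?d" "braket w w = 1"
    by (simp_all add: is_state_def)
  obtain c where c: "\<phi> = c \<cdot>\<^sub>v w"
    using spectral_gap_pos_imp_unique_fixed[OF test_proj_carrier[OF t] gap \<phi>c(1) \<phi>(2) wc(1) w(2) is_state_nonzero[OF ws]]
    by blast
  have "braket \<phi> \<phi> = cnj c * c"
    unfolding c using wc by (simp add: braket_smult_left[of _ ?d] braket_smult_right[of _ ?d])
  then show ?thesis
    using Prod_smult[OF w(1) dims, of c] c \<phi>c(2) by simp
qed

text \<open>Each party asks whether its subsystem is in the prescribed state, and the test accepts
  only if all answers are yes. The accepted projector is the product of the local ones, hence rank
  one.\<close>

lemma product_state_test:
  assumes "\<phi> \<in> Prod dims"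
  obtains t where "valid_test dims t" "test_proj dims t = ket_bra \<phi> \<phi>"
proof -
  obtain us where us: "\<phi> = kron_vec_list us" "list_all2 is_state dims us"
    using assms by (auto simp: Prod_iff)
  have len: "length us = length dims" and st: "\<And>i. i < length dims \<Longrightarrow> is_state (dims ! i) (us ! i)"
    using us(2) by (auto simp: list_all2_conv_all_nth)
  define Ms where "Ms = map (\<lambda>i. [ket_bra (us ! i) (us ! i), 1\<^sub>m (dims ! i) - ket_bra (us ! i) (us ! i)]) [0..<length dims]"
  \<comment> \<open>Index 0 is the answer yes at every party.\<close>
  define as where "as = replicate (length dims) (0 :: nat)"
  have "projective_measurement (dims ! i) (Ms ! i)" if i: "i < length dims" for i
  proof -
    let ?P = "ket_bra (us ! i) (us ! i)" and ?m = "dims ! i"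
    have P: "projector ?m ?P"
      using projector_ket_bra[OF st[OF i]] .
    moreover have "?P + (1\<^sub>m ?m - ?P + 0\<^sub>m ?m ?m) = 1\<^sub>m ?m"
      using P carrier_matD[of ?P ?m ?m] by (intro eq_matI) (auto simp: projector_def)
    ultimately show ?thesis
      using projector_complement[OF P] i by (simp add: projective_measurement_def Ms_def projector_def)
  qed
  then have lm: "local_measurement dims Ms"
    by (simp add: local_measurement_def Ms_def)
  have out: "outcome Ms as"
    by (simp add: outcome_def Ms_def as_def)
  have "outcome_factors Ms as = map (\<lambda>u. ket_bra u u) us"
    by (intro nth_equalityI) (auto simp: length_outcome_factors nth_outcome_factors Ms_def as_def len)
  then have "outcome_proj Ms as = ket_bra \<phi> \<phi>"
    by (simp add: outcome_proj_factors us(1) ket_bra_kron_vec_list)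
  then have "test_proj dims (Ms, [as]) = ket_bra \<phi> \<phi>"
    using outcome_proj_carrier[OF lm out] by (simp add: test_proj_def)
  moreover have "valid_test dims (Ms, [as])"
    using lm out by (simp add: valid_test_def)
  ultimately show thesis
    using that by blast
qed

text \<open>A channel that reproduces all output states passes every test, since each test fixes its
  target; reliability then identifies the channel. The protocol may be ordinary or not, so both (1)
  and (5) are served.\<close>

lemma reliable_inputs_IS:
  assumes U: "unitary_op (hdim dims) U" and pr: "gate_protocol dims U pr" "reliable dims U pr"
  shows "is_IS dims U (fst ` set pr)"
  unfolding is_IS_def
proof (intro conjI allI impI)
  have inp: "\<psi> \<in> Prod dims" "state_protocol dims (U *\<^sub>v \<psi>) ts" if "(\<psi>, q, ts) \<in> set pr" for \<psi> q ts
    using pr(1) that by (auto simp: gate_protocol_def)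
  then show "\<forall>v\<in>fst ` set pr. is_state (hdim dims) v"
    using Prod_is_state by force
  fix Ks
  assume Ks: "is_channel (hdim dims) Ks"
    and app: "\<forall>\<psi>\<in>fst ` set pr. apply_channel (hdim dims) Ks (ket_bra \<psi> \<psi>) = ket_bra (U *\<^sub>v \<psi>) (U *\<^sub>v \<psi>)"
  have "mtrace (test_proj dims t * apply_channel (hdim dims) Ks (ket_bra \<psi> \<psi>)) = 1"
    if pr': "(\<psi>, q, ts) \<in> set pr" and ts: "(t, p) \<in> set ts" for \<psi> q ts t p
  proof -
    let ?\<phi> = "U *\<^sub>v \<psi>"
    have t: "valid_test dims t" "test_proj dims t *\<^sub>v ?\<phi> = ?\<phi>"
      using inp(2)[OF pr'] ts by (auto simp: state_protocol_def)
    have "is_state (hdim dims) ?\<phi>"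
      using unitary_op_is_state[OF U Prod_is_state[OF inp(1)[OF pr']]] .
    then have \<phi>: "?\<phi> \<in> carrier_vec (hdim dims)" "braket ?\<phi> ?\<phi> = 1"
      by (simp_all add: is_state_def)
    have "apply_channel (hdim dims) Ks (ket_bra \<psi> \<psi>) = ket_bra ?\<phi> ?\<phi>"
      using app pr' by force
    then show ?thesis
      using mult_ket_bra[OF test_proj_carrier[OF t(1)] \<phi>(1) \<phi>(1)] t(2) mtrace_ket_bra[OF \<phi>(1) \<phi>(1)] \<phi>(2) by simp
  qed
  then have "passes_all_tests dims pr Ks"
    unfolding passes_all_tests_def by blast
  then show "is_unitary_channel_of (hdim dims) U Ks"
    using pr(2) Ks by (simp add: reliable_def)
qed

text \<open>One protocol witnesses both (5) and the upper bound on \<open>mu\<close>: each basis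
  state has a single test, whose projector is the output state itself and thus has a positive
  gap.\<close>

lemma EF_protocol_of_connected_basis:
  assumes U: "unitary_op (hdim dims) U" and d: "hdim dims \<ge> 2"
    and B: "connected_basis (hdim dims) B" "B \<subseteq> ProdU dims U"
  obtains pr where "gate_protocol dims U pr" "ordinary dims pr" "reliable dims U pr"
    "entanglement_free dims U pr" "num_settings pr = hdim dims"
proof -
  let ?d = "hdim dims"
  have fin: "finite B" "card B = ?d"
    using B is_basis_finite_card by (auto simp: connected_basis_def)
  obtain bs where bs: "set bs = B" "length bs = ?d"
    using finite_distinct_list[OF fin(1)] fin(2) distinct_card by metis
  have BP: "\<psi> \<in> Prod dims" "U *\<^sub>v \<psi> \<in> Prod dims" if "\<psi> \<in> B" for \<psi>
    using B(2) that by (auto simp: ProdU_def)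
  have "\<exists>t. valid_test dims t \<and> test_proj dims t = ket_bra (U *\<^sub>v \<psi>) (U *\<^sub>v \<psi>)" if "\<psi> \<in> B" for \<psi>
    using product_state_test[OF BP(2)[OF that]] by blast
  then obtain t where t: "\<And>\<psi>. \<psi> \<in> B \<Longrightarrow> valid_test dims (t \<psi>) \<and> test_proj dims (t \<psi>) = ket_bra (U *\<^sub>v \<psi>) (U *\<^sub>v \<psi>)"
    by metis
  \<comment> \<open>The inputs are chosen uniformly, and the only test of each has probability
    1.\<close>
  define pr where "pr = map (\<lambda>\<psi>. (\<psi>, 1 / real ?d, [(t \<psi>, 1 :: real)])) bs"
  have st: "is_state ?d (U *\<^sub>v \<psi>)" if "\<psi> \<in> B" for \<psi>
    using Prod_is_state[OF BP(2)[OF that]] .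
  have c: "U *\<^sub>v \<psi> \<in> carrier_vec ?d" "braket (U *\<^sub>v \<psi>) (U *\<^sub>v \<psi>) = 1" if "\<psi> \<in> B" for \<psi>
    using is_state_carrier[OF st[OF that]] is_state_braket[OF st[OF that]] by blast+
  have "state_protocol dims (U *\<^sub>v \<psi>) [(t \<psi>, 1)]" if \<psi>: "\<psi> \<in> B" for \<psi>
    using t[OF \<psi>] ket_bra_mult_vec[OF c(1)[OF \<psi>] c(1)[OF \<psi>] c(1)[OF \<psi>]] c(2)[OF \<psi>]
    by (simp add: state_protocol_def)
  moreover have "sum_list (map (fst \<circ> snd) pr) = 1"
    using bs d by (simp add: pr_def comp_def sum_list_triv)
  ultimately have gp: "gate_protocol dims U pr"
    using bs d BP unfolding gate_protocol_def by (auto simp: pr_def)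
  have "ordinary dims pr"
  proof -
    have "verification_operator dims [(t \<psi>, 1)] = ket_bra (U *\<^sub>v \<psi>) (U *\<^sub>v \<psi>)" if \<psi>: "\<psi> \<in> B" for \<psi>
      using t[OF \<psi>] ket_bra_carrier[OF c(1)[OF \<psi>] c(1)[OF \<psi>]] by (auto simp: verification_operator_def)
    then show ?thesis
      using spectral_gap_ket_bra_pos[OF st d] bs(1) by (auto simp: ordinary_def pr_def)
  qed
  moreover have "reliable dims U pr"
    unfolding reliable_def
  proof (intro allI impI)
    fix Ks
    assume Ks: "is_channel ?d Ks" and pass: "passes_all_tests dims pr Ks"
    show "is_unitary_channel_of ?d U Ks"
    proof (rule certain_pass_imp_unitary_channel[OF U _ connected_basis_imp_spanning[OF B(1)] Ks])
      fix \<psi>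
      assume "\<psi> \<in> B"
      then show "mtrace (ket_bra (U *\<^sub>v \<psi>) (U *\<^sub>v \<psi>) * apply_channel ?d Ks (ket_bra \<psi> \<psi>)) = 1"
        using pass t bs by (auto simp: passes_all_tests_def pr_def)
    qed (use d in simp)
  qed
  moreover have "entanglement_free dims U pr"
    using BP bs(1) by (auto simp: entanglement_free_def pr_def)
  moreover have "num_settings pr = ?d"
    using bs by (simp add: num_settings_def pr_def comp_def sum_list_triv)
  ultimately show thesis
    using that gp by blast
qed

section \<open>Counting experimental settings\<close>

lemma length_le_sum_list:
  fixes f :: "'a \<Rightarrow> nat"
  assumes "\<And>x. x \<in> set xs \<Longrightarrow> f x \<ge> 1"
  shows "length xs \<le> (\<Sum>x\<leftarrow>xs. f x)"
  using assms
proof (induction xs)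
  case (Cons y ys)
  then have "length ys \<le> (\<Sum>x\<leftarrow>ys. f x)" "f y \<ge> 1"
    by auto
  then show ?case
    by simp
qed simp

lemma sum_list_le_length_imp_1:
  fixes f :: "'a \<Rightarrow> nat"
  assumes "\<And>x. x \<in> set xs \<Longrightarrow> f x \<ge> 1" "(\<Sum>x\<leftarrow>xs. f x) \<le> length xs" "x \<in> set xs"
  shows "f x = 1"
  using assms
proof (induction xs)
  case (Cons y ys)
  have "length ys \<le> (\<Sum>x\<leftarrow>ys. f x)" "f y \<ge> 1"
    using Cons.prems(1) by (auto intro!: length_le_sum_list)
  then have "f y = 1" "(\<Sum>x\<leftarrow>ys. f x) \<le> length ys"
    using Cons.prems(2) by auto
  then show ?case
    using Cons by auto
qed simp

lemma gate_protocol_settings_pos: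
  assumes "gate_protocol dims U pr" "x \<in> set pr"
  shows "(case x of (\<psi>, q, ts) \<Rightarrow> length ts) \<ge> 1"
  using assms by (force simp: gate_protocol_def state_protocol_def Suc_le_eq)

text \<open>Bounds the number of protocol entries instead of settings; this stronger form is what
  allows only one test per entry in the case of equality. Entries may repeat an input state, so the
  count passes through the set of inputs.\<close>

lemma reliable_length_ge:
  assumes U: "unitary_op (hdim dims) U" and d: "hdim dims \<ge> 2"
    and pr: "gate_protocol dims U pr" "reliable dims U pr"
  shows "hdim dims \<le> length pr"
proof -
  have "spans (hdim dims) (fst ` set pr)"
    using IS_imp_connected_spanning[OF U d reliable_inputs_IS[OF U pr]] by (simp add: connected_spanning_set_def)
  then have "hdim dims \<le> card (fst ` set pr)"
    by (rule spans_imp_card_ge) simp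
  also have "\<dots> \<le> card (set pr)"
    by (rule card_image_le) simp
  also have "\<dots> \<le> length pr"
    by (rule card_length)
  finally show ?thesis .
qed

lemma num_settings_ge:
  assumes U: "unitary_op (hdim dims) U" and d: "hdim dims \<ge> 2"
    and pr: "gate_protocol dims U pr" "reliable dims U pr"
  shows "hdim dims \<le> num_settings pr"
  using reliable_length_ge[OF assms] length_le_sum_list[of pr] gate_protocol_settings_pos[OF pr(1)]
  unfolding num_settings_def by (meson order_trans)

text \<open>Dimension, number of entries and number of settings coincide, so every entry has exactly
  one test. Its probability is then 1, and the verification operator with its positive gap is the
  test projector itself.\<close>

lemma minimal_protocol_inputs:
  assumes U: "unitary_op (hdim dims) U" and d: "hdim dims \<ge> 2" and dims: "dims \<noteq> []"
    and pr: "gate_protocol dims U pr" "reliable dims U pr" "ordinary dims pr"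
    and num: "num_settings pr \<le> hdim dims"
  shows "fst ` set pr \<subseteq> ProdU dims U"
proof
  fix \<psi>
  assume "\<psi> \<in> fst ` set pr"
  then obtain q ts where x: "(\<psi>, q, ts) \<in> set pr"
    by auto
  have "num_settings pr \<le> length pr"
    using num reliable_length_ge[OF U d pr(1,2)] by simp
  then have "(case (\<psi>, q, ts) of (\<psi>, q, ts) \<Rightarrow> length ts) = 1"
    unfolding num_settings_def by (intro sum_list_le_length_imp_1[OF gate_protocol_settings_pos[OF pr(1)] _ x])
  then obtain t p where ts: "ts = [(t, p)]"
    by (auto simp: length_Suc_conv)
  have \<psi>: "\<psi> \<in> Prod dims" and sp: "state_protocol dims (U *\<^sub>v \<psi>) ts"
    using pr(1) x by (auto simp: gate_protocol_def)
  have t: "valid_test dims t" "test_proj dims t *\<^sub>v (U *\<^sub>v \<psi>) = U *\<^sub>v \<psi>" "p = 1"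
    using sp by (auto simp: state_protocol_def ts)
  have "verification_operator dims ts = test_proj dims t"
    using test_proj_carrier[OF t(1)] t(3) by (auto simp: verification_operator_def ts)
  then have "spectral_gap (test_proj dims t) > 0"
    using pr(3) x by (force simp: ordinary_def)
  then have "U *\<^sub>v \<psi> \<in> Prod dims"
    using single_test_product[OF t(1) unitary_op_is_state[OF U Prod_is_state[OF \<psi>]] t(2) _ dims] by simp
  then show "\<psi> \<in> ProdU dims U"
    using \<psi> by (simp add: ProdU_def)
qed

lemma hdim_ge_2:
  assumes "composite dims"
  shows "hdim dims \<ge> 2" "dims \<noteq> []"
proof -
  show ne: "dims \<noteq> []"
    using assms by (auto simp: composite_def)
  have "prod_list xs \<ge> 1" if "\<forall>m\<in>set xs. m \<ge> (2 :: nat)" for xs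
    using that by (induction xs) auto
  moreover obtain m ms where "dims = m # ms"
    using ne by (cases dims) auto
  ultimately show "hdim dims \<ge> 2"
    using assms mult_le_mono[of 2 m 1 "prod_list ms"] by (auto simp: composite_def hdim_def)
qed

theorem theorem2:
  fixes dims :: "nat list" and U :: "complex mat"
  assumes "composite dims"
    and "unitary_op (hdim dims) U"
  shows "(mu dims U = enat (hdim dims) \<longleftrightarrow> connected_spanning_set (hdim dims) (ProdU dims U))
       \<and> (connected_spanning_set (hdim dims) (ProdU dims U) \<longleftrightarrow>
            (\<exists>B. B \<subseteq> ProdU dims U \<and> connected_basis (hdim dims) B))
       \<and> ((\<exists>B. B \<subseteq> ProdU dims U \<and> connected_basis (hdim dims) B) \<longleftrightarrow> has_EFMIS dims U)
       \<and> (has_EFMIS dims U \<longleftrightarrow> EF_verifiable dims U)"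
proof -
  let ?d = "hdim dims"
  let ?css = "connected_spanning_set ?d (ProdU dims U)"
  let ?basis = "\<exists>B. B \<subseteq> ProdU dims U \<and> connected_basis ?d B"
  note d = hdim_ge_2[OF assms(1)]
  note U = assms(2)
  \<comment> \<open>Common gate for the implications from (1), (4) and (5) to (2).\<close>
  have IS_css: ?css if "is_IS dims U S" "S \<subseteq> ProdU dims U" for S
    using IS_imp_connected_spanning[OF U d(1) that(1)] that(2) ProdU_is_state
    by (rule connected_spanning_superset)
  have css_basis: "?css \<longleftrightarrow> ?basis"
  proof
    assume ?css
    then show ?basis
      using connected_spanning_contains_basis[of ?d "ProdU dims U"] d(1) by (metis gr0I not_numeral_le_zero)
  next
    assume ?basis
    then obtain B where "B \<subseteq> ProdU dims U" "connected_basis ?d B"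
      by blast
    then show ?css
      by (intro connected_spanning_superset[OF connected_basis_imp_spanning]) (auto intro: ProdU_is_state)
  qed
  have basis_EFMIS: "has_EFMIS dims U" if ?basis
    using that connected_basis_is_MIS[OF U d(1)] by (auto simp: has_EFMIS_def)
  have EFMIS_css: ?css if "has_EFMIS dims U"
    using that IS_css by (auto simp: has_EFMIS_def is_MIS_def)
  have basis_EF: "EF_verifiable dims U" if ?basis
    using that EF_protocol_of_connected_basis[OF U d(1)] unfolding EF_verifiable_def by metis
  have EF_css: ?css if EF: "EF_verifiable dims U"
  proof -
    obtain pr where pr: "gate_protocol dims U pr" "reliable dims U pr" "entanglement_free dims U pr"
      using EF by (auto simp: EF_verifiable_def)
    have "fst ` set pr \<subseteq> ProdU dims U"
      using pr(3) by (auto simp: entanglement_free_def ProdU_def)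
    then show ?thesis
      using IS_css[OF reliable_inputs_IS[OF U pr(1,2)]] by simp
  qed
  define X where "X = {pr. gate_protocol dims U pr \<and> ordinary dims pr \<and> reliable dims U pr}"
  have mu: "mu dims U = (INF pr\<in>X. enat (num_settings pr))"
    by (simp add: mu_def X_def)
  \<comment> \<open>If there is no reliable ordinary protocol, \<open>mu\<close> is an infimum over
    the empty set, that is infinity, and the bound still holds.\<close>
  have mu_ge: "enat ?d \<le> mu dims U"
    unfolding mu using num_settings_ge[OF U d(1)] by (intro INF_greatest) (auto simp: X_def)
  have basis_mu: "mu dims U = enat ?d" if basis: ?basis
  proof -
    obtain B where B: "B \<subseteq> ProdU dims U" "connected_basis ?d B"
      using basis by blast
    obtain pr where "gate_protocol dims U pr" "ordinary dims pr" "reliable dims U pr" "num_settings pr = ?d"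
      by (rule EF_protocol_of_connected_basis[OF U d(1) B(2,1)])
    then have "mu dims U \<le> enat ?d"
      unfolding mu by (intro INF_lower2[of pr]) (auto simp: X_def)
    then show ?thesis
      using mu_ge by simp
  qed
  have mu_css: ?css if "mu dims U = enat ?d"
  proof -
    \<comment> \<open>The infimum is attained because settings are integers: otherwise each
      protocol, and hence \<open>mu\<close>, would reach at least \<open>Suc ?d\<close>.\<close>
    have "\<exists>pr\<in>X. num_settings pr \<le> ?d"
    proof (rule ccontr)
      assume "\<not> ?thesis"
      then have "enat (Suc ?d) \<le> mu dims U"
        unfolding mu by (intro INF_greatest) (auto simp: not_le Suc_le_eq)
      then show False
        using that by simp
    qed
    then obtain pr where pr: "gate_protocol dims U pr" "reliable dims U pr" "ordinary dims pr"
      "num_settings pr \<le> ?d"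
      by (auto simp: X_def)
    show ?thesis
      using IS_css[OF reliable_inputs_IS[OF U pr(1,2)] minimal_protocol_inputs[OF U d pr]] .
  qed
  show ?thesis
    using css_basis basis_EFMIS EFMIS_css basis_EF EF_css basis_mu mu_css by blast
qed

end
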